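(* Let $G$ be a vertex-transitive graph whose vertex set $V$ has $n$ elements, and let $E\subset\mathbb{R}^n$ be an eigenspace of the adjacency matrix of $G$ with dimension $m$. Let $u\in\mathbb{R}^n$ be an eigenvector chosen according to the uniform probability measure $\mathbb{P}$ on the unit sphere of $E$. Set $$\mu=\frac1n\sum_{i\in V}\delta_{\sqrt{n}\,u_i}.$$ Then for any $\varepsilon$ such that $$\max\left(\left(\frac{192\pi}{\sqrt{m-1}}\right)^{2/5},\frac{4}{m-1}\right)\le\varepsilon\le1,$$ one has $$\mathbb{P}\left[d_{\mathrm{BL}}(\mu,\mathcal{N}(0,1))>\varepsilon\right]\le\frac{48\sqrt{\pi}}{\varepsilon^{3/2}}\exp\left(-c(m-1)\varepsilon^5\right),$$ where $c=3^{-2}2^{-16}$ and $\mathcal{N}(0,1)$ denotes the standard Gaussian distribution.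
   Context: A graph is vertex-transitive if its automorphism group acts transitively on its vertices. The unit sphere of $E$ is taken with respect to the Euclidean norm of $\mathbb{R}^n$. The bounded Lipschitz distance between probability measures $\mu,\nu$ on $\mathbb{R}$ is $$d_{\mathrm{BL}}(\mu,\nu)=\sup_{\|f\|_{\mathrm{BL}}\le1}\left|\int_{\mathbb{R}}f\,d\nu-\int_{\mathbb{R}}f\,d\mu\right|,\qquad\|f\|_{\mathrm{BL}}=\max\left\{\|f\|_{L^\infty},\ \sup_{x\ne y}\frac{|f(x)-f(y)|}{|x-y|}\right\}.$$ *)

theory Defs
  imports "HOL-Probability.Probability" "Graph_Theory.Digraph_Isomorphism"
begin

section \<open>Graphs and eigenspaces\<close>

text \<open>
  A simple undirected graph is a \<^locale>\<open>graph\<close>: a finite symmetric digraph without loops and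
  multiple arcs, each edge being represented by its two opposite arcs.
\<close>

definition adjacency_matrix :: "('v::finite, 'e) pre_digraph \<Rightarrow> real^'v^'v" where
  "adjacency_matrix G = (\<chi> i j. if i \<rightarrow>\<^bsub>G\<^esub> j then 1 else 0)"

definition graph_automorphism ::
    "('v, 'e) pre_digraph \<Rightarrow> ('v, 'e, 'v, 'e) digraph_isomorphism \<Rightarrow> bool" where
  "graph_automorphism G h \<longleftrightarrow> pre_digraph.digraph_isomorphism G h \<and> app_iso h G = G"

definition vertex_transitive :: "('v, 'e) pre_digraph \<Rightarrow> bool" where
  "vertex_transitive G \<longleftrightarrow>
     (\<forall>v\<in>verts G. \<forall>w\<in>verts G. \<exists>h. graph_automorphism G h \<and> iso_verts h v = w)"

definition is_eigenspace :: "real^'v^'v \<Rightarrow> (real^'v) set \<Rightarrow> bool" where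
  "is_eigenspace A E \<longleftrightarrow> E \<noteq> {0} \<and> (\<exists>l. E = {x. A *v x = l *\<^sub>R x})"

section \<open>The uniform probability measure on the unit sphere of a subspace\<close>

definition orthonormal_basis :: "'a::euclidean_space set \<Rightarrow> 'a set \<Rightarrow> bool" where
  "orthonormal_basis E B \<longleftrightarrow> pairwise orthogonal B \<and> (\<forall>b\<in>B. norm b = 1) \<and> span B = E"

text \<open>
  Lebesgue measure on a subspace \<open>E\<close>, as a Borel measure on the ambient space, is the image of the
  product Lebesgue measure under the coordinates of an orthonormal basis of \<open>E\<close>. By rotation
  invariance of Lebesgue measure the choice of the basis is immaterial.
\<close>

definition subspace_lborel :: "'a::euclidean_space set \<Rightarrow> 'a measure" where
  "subspace_lborel E =
     (let B = (SOME B. orthonormal_basis E B)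
      in distr (\<Pi>\<^sub>M b\<in>B. lborel) borel (\<lambda>x. \<Sum>b\<in>B. x b *\<^sub>R b))"

text \<open>
  Normalised surface measure on the unit sphere of \<open>E\<close>: the measure of a set \<open>A\<close> of unit vectors
  is the proportion of the unit ball of \<open>E\<close> that lies in the cone over \<open>A\<close>. Here \<open>sgn x\<close> is
  \<open>x /\<^sub>R norm x\<close>.
\<close>

definition uniform_unit_sphere :: "'a::euclidean_space set \<Rightarrow> 'a measure" where
  "uniform_unit_sphere E = distr (uniform_measure (subspace_lborel E) (ball 0 1)) borel sgn"

lemma orthonormal_basis_some:
  fixes E :: "'a::euclidean_space set"
  assumes "subspace E"
  shows "orthonormal_basis E (SOME B. orthonormal_basis E B)"
proof -
  obtain B where "B \<subseteq> E" "pairwise orthogonal B" "\<And>x. x \<in> B \<Longrightarrow> norm x = 1" "span B = E"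
    using orthonormal_basis_subspace[OF assms] by metis
  then have "orthonormal_basis E B" by (auto simp: orthonormal_basis_def)
  then show ?thesis by (rule someI)
qed

lemma
  fixes E :: "'a::euclidean_space set"
  assumes E: "subspace E" "E \<noteq> {0}"
  shows prob_space_uniform_unit_sphere: "prob_space (uniform_unit_sphere E)"
    and AE_uniform_unit_sphere: "AE u in uniform_unit_sphere E. u \<in> E \<inter> sphere 0 1"
proof -
  define B where "B = (SOME B. orthonormal_basis E B)"
  define T where "T = (\<lambda>x. \<Sum>b\<in>B. x b *\<^sub>R (b::'a))"
  define P where "P = (\<Pi>\<^sub>M b\<in>B. (lborel::real measure))"
  have onb: "orthonormal_basis E B" unfolding B_def by (rule orthonormal_basis_some[OF E(1)])
  have fB: "finite B" using onb pairwise_orthogonal_imp_finite by (auto simp: orthonormal_basis_def)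
  have Bne: "B \<noteq> {}" using onb E by (auto simp: orthonormal_basis_def)
  have meas[measurable]: "T \<in> P \<rightarrow>\<^sub>M borel" unfolding T_def P_def by measurable
  have L: "subspace_lborel E = distr P borel T"
    by (simp add: subspace_lborel_def B_def T_def P_def Let_def)
  have n2: "norm (T x) ^ 2 = (\<Sum>b\<in>B. (x b)^2)" for x
  proof -
    have "norm (T x) ^ 2 = (\<Sum>b\<in>B. norm (x b *\<^sub>R b) ^ 2)" unfolding T_def
      using onb fB by (intro norm_sum_Pythagorean) (auto simp: orthonormal_basis_def pairwise_def orthogonal_clauses)
    also have "\<dots> = (\<Sum>b\<in>B. (x b)^2)" using onb by (auto simp: orthonormal_basis_def power_mult_distrib intro!: sum.cong)
    finally show ?thesis .
  qed
  interpret product_sigma_finite "\<lambda>_::'a. lborel::real measure" by standard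
  define r where "r = 1 / (2 * sqrt (card B))"
  have c: "card B > 0" using fB Bne by (simp add: card_gt_0_iff)
  have r: "r > 0" using c by (simp add: r_def)
  have sp: "space P = Pi\<^sub>E B (\<lambda>_. UNIV)" by (simp add: P_def space_PiM)
  have emb: "emeasure P (Pi\<^sub>E B (\<lambda>_. {-s..s})) = ennreal (2 * s) ^ card B" if "s > 0" for s
    unfolding P_def using fB that by (subst emeasure_PiM) auto
  have emL: "emeasure (subspace_lborel E) A = emeasure P (T -` A \<inter> space P)" if "A \<in> sets borel" for A
    unfolding L using that by (simp add: emeasure_distr)
  have lo: "Pi\<^sub>E B (\<lambda>_. {-r..r}) \<subseteq> T -` ball 0 1 \<inter> space P"
  proof
    fix x assume x: "x \<in> Pi\<^sub>E B (\<lambda>_. {-r..r})"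
    have "(\<Sum>b\<in>B. (x b)^2) \<le> (\<Sum>b\<in>B. r^2)"
      by (intro sum_mono) (use x r in \<open>auto simp: PiE_iff abs_le_iff minus_le_iff intro!: power2_le_iff_abs_le[THEN iffD2]\<close>)
    also have "\<dots> = card B * r^2" by simp
    also have "\<dots> < 1" using c by (simp add: r_def field_simps power2_eq_square)
    finally have "norm (T x) ^ 2 < 1^2" by (simp add: n2)
    then have "norm (T x) < 1" by (rule power_less_imp_less_base) simp
    then show "x \<in> T -` ball 0 1 \<inter> space P" using x by (auto simp: sp)
  qed
  have hi: "T -` ball 0 1 \<inter> space P \<subseteq> Pi\<^sub>E B (\<lambda>_. {-1..1})"
  proof
    fix x assume x: "x \<in> T -` ball 0 1 \<inter> space P"
    have "x b \<in> {-1..1}" if "b \<in> B" for b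
    proof -
      have "(x b)^2 \<le> (\<Sum>b\<in>B. (x b)^2)" using fB that by (intro member_le_sum) auto
      also have "\<dots> = norm (T x) ^ 2" by (simp add: n2)
      also have "\<dots> \<le> 1" using x by (simp add: power_le_one)
      finally show ?thesis by (simp add: abs_square_le_1 abs_le_iff)
    qed
    then show "x \<in> Pi\<^sub>E B (\<lambda>_. {-1..1})" using x by (auto simp: sp)
  qed
  have pos: "emeasure (subspace_lborel E) (ball 0 1) \<noteq> 0"
  proof
    assume "emeasure (subspace_lborel E) (ball 0 1) = 0"
    then have "emeasure P (T -` ball 0 1 \<inter> space P) = 0" by (simp add: emL)
    moreover have "emeasure P (Pi\<^sub>E B (\<lambda>_. {-r..r})) \<le> emeasure P (T -` ball 0 1 \<inter> space P)"
      by (rule emeasure_mono[OF lo]) measurable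
    ultimately show False using emb[OF r] r by (auto simp: ennreal_eq_0_iff)
  qed
  have "emeasure P (T -` ball 0 1 \<inter> space P) \<le> emeasure P (Pi\<^sub>E B (\<lambda>_. {-1..1}))"
    by (rule emeasure_mono[OF hi]) (auto simp: P_def fB intro!: sets_PiM_I_finite)
  then have fin: "emeasure (subspace_lborel E) (ball 0 1) \<noteq> \<infinity>"
    using emb[of 1] by (auto simp: emL top_unique power_eq_top_ennreal)
  have setsL[measurable_cong]: "sets (subspace_lborel E) = sets borel" by (simp add: L)
  interpret U: prob_space "uniform_measure (subspace_lborel E) (ball 0 1)"
    by (rule prob_space_uniform_measure[OF pos fin])
  have sgnm[measurable]: "(sgn :: 'a \<Rightarrow> 'a) \<in> borel \<rightarrow>\<^sub>M borel"
    unfolding sgn_div_norm[abs_def] by measurable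
  have sgnm': "sgn \<in> uniform_measure (subspace_lborel E) (ball 0 1) \<rightarrow>\<^sub>M borel"
    using sgnm setsL by (simp cong: measurable_cong_sets)
  show "prob_space (uniform_unit_sphere E)"
    unfolding uniform_unit_sphere_def by (rule U.prob_space_distr[OF sgnm'])
  have cl: "closed (E \<inter> sphere 0 1)" using E by (simp add: closed_subspace closed_Int)
  have b0: "emeasure (subspace_lborel E) {0} = 0"
  proof -
    have "T -` {0} \<inter> space P = Pi\<^sub>E B (\<lambda>_. {0})"
    proof -
      have "T x = 0 \<longleftrightarrow> (\<forall>b\<in>B. x b = 0)" for x
        using n2[of x] fB sum_nonneg_eq_0_iff[of B "\<lambda>b. (x b)^2"] by auto
      then show ?thesis by (auto simp: sp PiE_iff extensional_def fun_eq_iff)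
    qed
    moreover have "emeasure P (Pi\<^sub>E B (\<lambda>_. {0})) = 0"
      unfolding P_def using fB Bne by (subst emeasure_PiM) (auto simp: prod_zero_iff)
    ultimately show ?thesis by (simp add: emL)
  qed
  have "AE x in subspace_lborel E. x \<in> E"
    unfolding L
  proof (subst AE_distr_iff[OF meas])
    show "{x \<in> space borel. x \<in> E} \<in> sets borel" using closed_subspace[OF E(1)] by simp
    have "T x \<in> E" for x unfolding T_def
      using onb by (auto simp: orthonormal_basis_def intro!: span_sum intro: span_scale span_base)
    then show "AE x in P. T x \<in> E" by simp
  qed
  moreover have "AE x in subspace_lborel E. x \<noteq> 0"
    using b0 by (intro AE_I[where N="{0}"]) (auto simp: setsL)
  ultimately have "AE x in subspace_lborel E. x \<in> ball 0 1 \<longrightarrow> sgn x \<in> E \<inter> sphere 0 1"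
    by eventually_elim (use E in \<open>auto simp: norm_sgn sgn_div_norm subspace_scale\<close>)
  then have "AE x in uniform_measure (subspace_lborel E) (ball 0 1). sgn x \<in> E \<inter> sphere 0 1"
    by (intro AE_uniform_measureI) (auto simp: setsL)
  then show "AE u in uniform_unit_sphere E. u \<in> E \<inter> sphere 0 1"
    unfolding uniform_unit_sphere_def using borel_closed[OF cl] by (subst AE_distr_iff[OF sgnm']) (simp_all add: Int_def)
qed

section \<open>The bounded Lipschitz distance and the empirical measure\<close>

definition bl_norm :: "(real \<Rightarrow> real) \<Rightarrow> ereal" where
  "bl_norm f = max (esssup lborel (\<lambda>x. ereal \<bar>f x\<bar>))
                   (SUP (x, y)\<in>{(x, y). x \<noteq> y}. ereal (\<bar>f x - f y\<bar> / \<bar>x - y\<bar>))"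

definition bl_dist :: "real measure \<Rightarrow> real measure \<Rightarrow> real" where
  "bl_dist \<mu> \<nu> = (SUP f\<in>{f. bl_norm f \<le> 1}. \<bar>(\<integral>x. f x \<partial>\<nu>) - (\<integral>x. f x \<partial>\<mu>)\<bar>)"

text \<open>
  The image of normalised counting measure under \<open>i \<mapsto> sqrt n * u\<^sub>i\<close> is the average of the point
  masses at the rescaled coordinates of \<open>u\<close>.
\<close>

definition empirical_measure :: "real^'v \<Rightarrow> real measure" where
  "empirical_measure u =
     distr (uniform_count_measure (UNIV :: 'v set)) borel (\<lambda>i. sqrt (real CARD('v)) * u $ i)"

end

theory Submission
  imports Defs
begin

text \<open>
  If \<open>g\<close> is a standard Gaussian vector in \<open>E\<close>, then \<open>g /\<^sub>R norm g\<close> is uniform on the unit sphere, and by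
  transitivity every coordinate of \<open>sqrt (n / m) * g\<close> is exactly \<open>N(0,1)\<close>. Hence for a test function \<open>f\<close>
  the average \<open>F(g)\<close> of \<open>f (sqrt (n / m) * g\<^sub>i)\<close> over \<open>i\<close> has mean \<open>\<integral>f dN(0,1)\<close>; it is \<open>1 / sqrt m\<close>-Lipschitz in
  \<open>g\<close> when \<open>f\<close> is 1-Lipschitz, so that it concentrates by the argument of Maurey and Pisier, and replacing
  \<open>sqrt n * g / norm g\<close> by \<open>sqrt (n / m) * g\<close> costs at most the relative deviation of \<open>norm g\<close> from \<open>sqrt m\<close>.
  Up to an error controlled by the second moment, \<open>f\<close> is a combination of \<open>K\<close> smoothed steps with
  coefficients of modulus at most \<open>h\<close>, and the worst such combination has coefficients \<open>h\<close> or \<open>-h\<close>.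
  A union bound over these \<open>2\<^sup>K\<close> functions suffices, since \<open>K\<close> is of order \<open>1 / \<epsilon>\<^sup>2\<close> while the
  lower bound on \<open>\<epsilon>\<close> makes \<open>m * \<epsilon>\<^sup>2\<close> at least a large multiple of \<open>1 / \<epsilon>\<^sup>3\<close>.
\<close>

section \<open>Lebesgue measure on a subspace\<close>

text \<open>The supremum in the distance runs over an uncountable class, whereas concentration
  treats one function at a time and differentiates it. The class must therefore be replaced by
  finitely many continuously differentiable functions with a common Lipschitz constant. Steps whose
  derivatives have disjoint supports achieve this: every choice of weights in \<open>[-1, 1]\<close>
  keeps the slope at most 2, so that passing to arbitrary sign patterns costs only a factor 2 in the
  Lipschitz constant. The Gaussian measure is preferred to the sphere for two reasons. Its
  coordinates have an explicit law, so the mean of each test average is exact and no bias term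
  arises. An independent pair is invariant under the rotations mixing its two members, which is all
  that the concentration argument uses. The tail exponent obtained is of order
  \<open>m * \<epsilon>\<^sup>2\<close>, which for \<open>\<epsilon> \<le> 1\<close> dominates
  \<open>(m - 1) * \<epsilon> ^ 5\<close>. Hence mesh, cutoff and thresholds need no optimisation
  and are chosen for simple arithmetic.\<close>

locale nonzero_subspace =
  fixes E :: "'a::euclidean_space set"
  assumes subspace: "subspace E" and nonzero: "E \<noteq> {0}"
begin

text \<open>The same choice term as in \<open>subspace_lborel\<close>, so that \<open>L_eq\<close>
  holds by unfolding and no independence of the basis has to be proved.\<close>

definition B :: "'a set" where "B = (SOME B. orthonormal_basis E B)"

definition T :: "('a \<Rightarrow> real) \<Rightarrow> 'a" where "T x = (\<Sum>b\<in>B. x b *\<^sub>R b)"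

abbreviation P :: "('a \<Rightarrow> real) measure" where "P \<equiv> \<Pi>\<^sub>M b\<in>B. lborel"

abbreviation L :: "'a measure" where "L \<equiv> subspace_lborel E"

abbreviation d :: nat where "d \<equiv> dim E"

lemma onb: "orthonormal_basis E B"
  unfolding B_def by (rule orthonormal_basis_some[OF subspace])

lemma finite_B [simp, intro]: "finite B"
  using onb pairwise_orthogonal_imp_finite by (auto simp: orthonormal_basis_def)

lemma B_subset: "b \<in> B \<Longrightarrow> b \<in> E"
  using onb by (auto simp: orthonormal_basis_def intro: span_base)

lemma B_inner: "b \<in> B \<Longrightarrow> b' \<in> B \<Longrightarrow> b \<bullet> b' = (if b = b' then 1 else 0)"
  using onb by (auto simp: orthonormal_basis_def pairwise_def orthogonal_def norm_eq_1)

lemma card_B: "card B = d"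
proof -
  have "independent B"
    using onb by (intro pairwise_orthogonal_independent) (auto simp: orthonormal_basis_def)
  then show ?thesis
    using onb by (metis dim_eq_card_independent dim_span orthonormal_basis_def)
qed

lemma dim_pos: "d > 0"
  using subspace nonzero by (metis dim_eq_0 gr0I subset_singletonD subspace_0 empty_iff)

lemma T_in: "T x \<in> E"
  unfolding T_def using B_subset subspace by (intro subspace_sum) (auto intro: subspace_scale)

lemma T_inner_basis: "b \<in> B \<Longrightarrow> T x \<bullet> b = x b"
  by (simp add: T_def inner_sum_left B_inner if_distrib sum.delta' cong: if_cong)

lemma T_inner: "T x \<bullet> a = (\<Sum>b\<in>B. x b * (b \<bullet> a))"
  by (simp add: T_def inner_sum_left)

lemma norm_T: "(norm (T x))\<^sup>2 = (\<Sum>b\<in>B. (x b)\<^sup>2)"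
  by (subst power2_norm_eq_inner, subst (2) T_def)
     (simp add: inner_sum_right T_inner_basis power2_eq_square)

lemma T_expand:
  assumes "a \<in> E" shows "T (\<lambda>b. b \<bullet> a) = a"
proof -
  have "(\<Sum>b\<in>B. (a \<bullet> b) *\<^sub>R b) = a"
    using onb assms by (intro orthonormal_basis_expand) (auto simp: orthonormal_basis_def)
  then show ?thesis
    by (simp add: T_def inner_commute)
qed

lemma norm_eq_sum_B:
  assumes "a \<in> E" shows "(norm a)\<^sup>2 = (\<Sum>b\<in>B. (b \<bullet> a)\<^sup>2)"
  using norm_T[of "\<lambda>b. b \<bullet> a"] T_expand[OF assms] by simp

lemma T_measurable:
  assumes "\<And>b. b \<in> B \<Longrightarrow> sets (M b) = sets borel"
  shows "T \<in> PiM B M \<rightarrow>\<^sub>M borel"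
  unfolding T_def
proof (rule borel_measurable_sum)
  fix b assume b: "b \<in> B"
  have [measurable]: "(\<lambda>x. x b) \<in> PiM B M \<rightarrow>\<^sub>M borel"
    using measurable_component_singleton[OF b, of M] assms[OF b] by (simp cong: measurable_cong_sets)
  show "(\<lambda>x. x b *\<^sub>R b) \<in> PiM B M \<rightarrow>\<^sub>M borel" by measurable
qed

lemma T_measurable_P [measurable]: "T \<in> P \<rightarrow>\<^sub>M borel"
  by (rule T_measurable) simp

lemma L_eq: "L = distr P borel T"
  by (simp add: subspace_lborel_def B_def T_def[abs_def] Let_def)

lemma sets_L [simp, measurable_cong]: "sets L = sets borel"
  by (simp add: L_eq)

lemma space_L [simp]: "space L = UNIV"
  by (simp add: L_eq)

sublocale P: product_sigma_finite "\<lambda>_::'a. lborel::real measure"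
  by standard

lemma AE_L_in: "AE x in L. x \<in> E"
proof -
  have "closed E" by (rule closed_subspace[OF subspace])
  then have "{x \<in> space borel. x \<in> E} \<in> sets borel" by simp
  then show ?thesis
    unfolding L_eq by (subst AE_distr_iff[OF T_measurable_P]) (auto simp: T_in)
qed

section \<open>Translation and scaling of Lebesgue measure on the subspace\<close>

lemma P_translate: "distr P P (\<lambda>x. \<lambda>b\<in>B. x b + c b) = P"
proof (rule P.PiM_eqI)
  have [measurable]: "(\<lambda>x. \<lambda>b\<in>B. x b + c b) \<in> P \<rightarrow>\<^sub>M P" by measurable
  fix A :: "'a \<Rightarrow> real set" assume A: "\<And>i. i \<in> B \<Longrightarrow> A i \<in> sets lborel"
  then have [measurable]: "Pi\<^sub>E B A \<in> sets P" by (intro sets_PiM_I_finite) auto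
  have meas: "(\<lambda>x. x + c i) -` A i \<in> sets lborel" if "i \<in> B" for i
    using measurable_sets[of "\<lambda>x. x + c i" borel borel "A i"] A[OF that] by simp
  have "emeasure (distr P P (\<lambda>x. \<lambda>b\<in>B. x b + c b)) (Pi\<^sub>E B A)
      = emeasure P ((\<lambda>x. \<lambda>b\<in>B. x b + c b) -` Pi\<^sub>E B A \<inter> space P)"
    by (rule emeasure_distr) measurable
  also have "(\<lambda>x. \<lambda>b\<in>B. x b + c b) -` Pi\<^sub>E B A \<inter> space P = Pi\<^sub>E B (\<lambda>i. (\<lambda>x. x + c i) -` A i)"
    by (auto simp: space_PiM PiE_iff)
  also have "emeasure P \<dots> = (\<Prod>i\<in>B. emeasure lborel ((\<lambda>x. x + c i) -` A i))"
    using meas by (intro P.emeasure_PiM) auto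
  also have "\<dots> = (\<Prod>i\<in>B. emeasure lborel (A i))"
  proof (rule prod.cong[OF refl])
    fix i assume i: "i \<in> B"
    have "emeasure lborel (A i) = emeasure (distr lborel borel (\<lambda>x. c i + x)) (A i)"
      by (simp add: lborel_distr_plus)
    also have "\<dots> = emeasure lborel ((\<lambda>x. x + c i) -` A i)"
      using A[OF i] by (subst emeasure_distr) (auto simp: add.commute[of _ "c i"])
    finally show "emeasure lborel ((\<lambda>x. x + c i) -` A i) = emeasure lborel (A i)" by simp
  qed
  finally show "emeasure (distr P P (\<lambda>x. \<lambda>b\<in>B. x b + c b)) (Pi\<^sub>E B A) = (\<Prod>i\<in>B. emeasure lborel (A i))" .
qed auto

text \<open>The measure \<open>L\<close> lives on \<open>E\<close>, so the shift has to be along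
  \<open>E\<close>; there it becomes a shift of each coordinate under \<open>T\<close>.\<close>

lemma nn_integral_L_translate:
  assumes a: "a \<in> E" and [measurable]: "f \<in> borel_measurable borel"
  shows "(\<integral>\<^sup>+ x. f (x + a) \<partial>L) = (\<integral>\<^sup>+ x. f x \<partial>L)"
proof -
  have T: "T (\<lambda>b\<in>B. x b + b \<bullet> a) = T x + a" for x
    using T_expand[OF a] by (simp add: T_def scaleR_add_left sum.distrib)
  have [measurable]: "(\<lambda>x. \<lambda>b\<in>B. x b + b \<bullet> a) \<in> P \<rightarrow>\<^sub>M P" by measurable
  have "(\<integral>\<^sup>+ x. f x \<partial>L) = (\<integral>\<^sup>+ x. f (T x) \<partial>P)"
    by (simp add: L_eq nn_integral_distr)
  also have "\<dots> = (\<integral>\<^sup>+ x. f (T x) \<partial>distr P P (\<lambda>x. \<lambda>b\<in>B. x b + b \<bullet> a))"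
    by (simp add: P_translate)
  also have "\<dots> = (\<integral>\<^sup>+ x. f (T x + a) \<partial>P)"
    by (subst nn_integral_distr) (simp_all only: T, measurable)
  also have "\<dots> = (\<integral>\<^sup>+ x. f (x + a) \<partial>L)"
    by (simp add: L_eq nn_integral_distr)
  finally show ?thesis by simp
qed

lemma P_scale:
  assumes r: "r > 0"
  shows "scale_measure (ennreal r ^ d) (distr P P (\<lambda>x. \<lambda>b\<in>B. r * x b)) = P"
proof (rule P.PiM_eqI)
  have [measurable]: "(\<lambda>x. \<lambda>b\<in>B. r * x b) \<in> P \<rightarrow>\<^sub>M P" by measurable
  fix A :: "'a \<Rightarrow> real set" assume A: "\<And>i. i \<in> B \<Longrightarrow> A i \<in> sets lborel"
  then have [measurable]: "Pi\<^sub>E B A \<in> sets P" by (intro sets_PiM_I_finite) auto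
  have meas: "(\<lambda>x. r * x) -` A i \<in> sets lborel" if "i \<in> B" for i
    using measurable_sets[of "\<lambda>x. r * x" borel borel "A i"] A[OF that] by simp
  have "emeasure (distr P P (\<lambda>x. \<lambda>b\<in>B. r * x b)) (Pi\<^sub>E B A)
      = emeasure P ((\<lambda>x. \<lambda>b\<in>B. r * x b) -` Pi\<^sub>E B A \<inter> space P)"
    by (rule emeasure_distr) measurable
  also have "(\<lambda>x. \<lambda>b\<in>B. r * x b) -` Pi\<^sub>E B A \<inter> space P = Pi\<^sub>E B (\<lambda>i. (\<lambda>x. r * x) -` A i)"
    by (auto simp: space_PiM PiE_iff)
  also have "emeasure P \<dots> = (\<Prod>i\<in>B. emeasure lborel ((\<lambda>x. r * x) -` A i))"
    using meas by (intro P.emeasure_PiM) auto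
  finally have "emeasure (scale_measure (ennreal r ^ d) (distr P P (\<lambda>x. \<lambda>b\<in>B. r * x b))) (Pi\<^sub>E B A)
      = (\<Prod>i\<in>B. ennreal r * emeasure lborel ((\<lambda>x. r * x) -` A i))"
    by (simp only: emeasure_scale_measure prod.distrib prod_constant card_B)
  also have "\<dots> = (\<Prod>i\<in>B. emeasure lborel (A i))"
  proof (rule prod.cong[OF refl])
    fix i assume i: "i \<in> B"
    have "emeasure lborel ((\<lambda>x. r * x) -` A i) = emeasure (distr lborel borel (\<lambda>x. r * x)) (A i)"
      using A[OF i] by (subst emeasure_distr) auto
    also have "\<dots> = ennreal (inverse r) * emeasure lborel (A i)"
      using r A[OF i] by (subst lborel_distr_mult) (auto simp: emeasure_density nn_integral_cmult_indicator)
    finally show "ennreal r * emeasure lborel ((\<lambda>x. r * x) -` A i) = emeasure lborel (A i)"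
      using r by (simp add: ennreal_mult[symmetric] mult.assoc[symmetric])
  qed
  finally show "emeasure (scale_measure (ennreal r ^ d) (distr P P (\<lambda>x. \<lambda>b\<in>B. r * x b))) (Pi\<^sub>E B A)
      = (\<Prod>i\<in>B. emeasure lborel (A i))" .
qed auto

lemma nn_integral_L_scale:
  assumes r: "r > 0" and [measurable]: "f \<in> borel_measurable borel"
  shows "(\<integral>\<^sup>+ x. f x \<partial>L) = ennreal (r ^ d) * (\<integral>\<^sup>+ x. f (r *\<^sub>R x) \<partial>L)"
proof -
  have T: "T (\<lambda>b\<in>B. r * x b) = r *\<^sub>R T x" for x
    by (simp add: T_def scaleR_sum_right)
  have [measurable]: "(\<lambda>x. \<lambda>b\<in>B. r * x b) \<in> P \<rightarrow>\<^sub>M P" by measurable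
  have "(\<integral>\<^sup>+ x. f x \<partial>L) = (\<integral>\<^sup>+ x. f (T x) \<partial>P)"
    by (simp add: L_eq nn_integral_distr)
  also have "\<dots> = (\<integral>\<^sup>+ x. f (T x) \<partial>scale_measure (ennreal r ^ d) (distr P P (\<lambda>x. \<lambda>b\<in>B. r * x b)))"
    by (simp add: P_scale[OF r])
  also have "\<dots> = ennreal r ^ d * (\<integral>\<^sup>+ x. f (r *\<^sub>R T x) \<partial>P)"
  proof -
    have "(\<integral>\<^sup>+ x. f (T x) \<partial>distr P P (\<lambda>x. \<lambda>b\<in>B. r * x b)) = (\<integral>\<^sup>+ x. f (r *\<^sub>R T x) \<partial>P)"
      by (subst nn_integral_distr) (simp_all only: T, measurable)
    moreover have "(\<lambda>x. f (T x)) \<in> borel_measurable (distr P P (\<lambda>x. \<lambda>b\<in>B. r * x b))"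
      by simp
    ultimately show ?thesis
      by (simp only: nn_integral_scale_measure)
  qed
  also have "\<dots> = ennreal (r ^ d) * (\<integral>\<^sup>+ x. f (r *\<^sub>R x) \<partial>L)"
    using r by (simp add: L_eq nn_integral_distr ennreal_power)
  finally show ?thesis .
qed

text \<open>The total mass of \<open>uniform_unit_sphere E\<close> is the quotient of the ball's
  mass by itself. In \<open>ennreal\<close> both 0/0 and \<infinity>/\<infinity> are 0, so a
  quotient of 1 excludes the two degenerate values.\<close>

lemma emeasure_L_unit_ball: "emeasure L (ball 0 1) \<noteq> 0" "emeasure L (ball 0 1) \<noteq> \<infinity>"
proof -
  interpret U: prob_space "uniform_unit_sphere E"
    by (rule prob_space_uniform_unit_sphere[OF subspace nonzero])
  have [measurable]: "(sgn :: 'a \<Rightarrow> 'a) \<in> borel_measurable borel"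
    unfolding sgn_div_norm[abs_def] by measurable
  have "space (uniform_unit_sphere E) = UNIV"
    by (simp add: uniform_unit_sphere_def)
  then have "1 = emeasure (uniform_unit_sphere E) UNIV"
    using U.emeasure_space_1 by (simp only:)
  also have "\<dots> = emeasure (uniform_measure L (ball 0 1)) UNIV"
    unfolding uniform_unit_sphere_def by (subst emeasure_distr) (auto cong: measurable_cong_sets)
  also have "\<dots> = emeasure L (ball 0 1 \<inter> UNIV) / emeasure L (ball 0 1)"
    by (rule emeasure_uniform_measure) auto
  finally have "emeasure L (ball 0 1) / emeasure L (ball 0 1) = 1"
    by (simp only: Int_UNIV_right)
  then show "emeasure L (ball 0 1) \<noteq> 0" "emeasure L (ball 0 1) \<noteq> \<infinity>"
    by (auto simp: divide_ennreal_def)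
qed

lemma emeasure_L_ball:
  assumes r: "r > 0"
  shows "emeasure L (ball 0 r) = ennreal (r ^ d) * emeasure L (ball 0 1)"
proof -
  have "emeasure L (ball 0 r) = (\<integral>\<^sup>+ x. indicator (ball 0 r) x \<partial>L)" by simp
  also have "\<dots> = ennreal (r ^ d) * (\<integral>\<^sup>+ x. indicator (ball 0 r) (r *\<^sub>R x) \<partial>L)"
    by (rule nn_integral_L_scale[OF r]) (intro borel_measurable_indicator borel_open open_ball)
  also have "(\<lambda>x::'a. indicator (ball 0 r) (r *\<^sub>R x) :: ennreal) = indicator (ball 0 1)"
    using r by (auto simp: fun_eq_iff indicator_def)
  finally show ?thesis by simp
qed

sublocale L: sigma_finite_measure L
proof
  show "\<exists>A. countable A \<and> A \<subseteq> sets L \<and> \<Union>A = space L \<and> (\<forall>a\<in>A. emeasure L a \<noteq> \<infinity>)"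
  proof (intro exI[of _ "range (\<lambda>n::nat. ball 0 (real (Suc n)))"] conjI ballI)
    show "\<Union> (range (\<lambda>n. ball 0 (real (Suc n)))) = space L"
    proof -
      have "x \<in> (\<Union>n. ball 0 (real (Suc n)))" for x :: 'a
      proof -
        obtain n where "norm x < real n" using reals_Archimedean2 by blast
        then have "x \<in> ball 0 (real (Suc n))" by simp
        then show ?thesis by (intro UN_I UNIV_I)
      qed
      then show ?thesis unfolding space_L by (intro equalityI subsetI UNIV_I)
    qed
    fix a assume "a \<in> range (\<lambda>n::nat. ball 0 (real (Suc n)) :: 'a set)"
    then show "emeasure L a \<noteq> \<infinity>"
    proof -
      obtain n where "a = ball 0 (real (Suc n))"
        using \<open>a \<in> _\<close> by (rule imageE)
      moreover have "emeasure L (ball 0 (real (Suc n))) \<noteq> \<infinity>"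
        using emeasure_L_unit_ball(2) by (subst emeasure_L_ball) (auto simp: ennreal_mult_eq_top_iff)
      ultimately show ?thesis by simp
    qed
  qed auto
qed

section \<open>The standard Gaussian measure on a subspace\<close>

definition gauss :: "'a measure" where
  "gauss = distr (\<Pi>\<^sub>M b\<in>B. std_normal_distribution) borel T"

definition gauss_density :: "'a \<Rightarrow> real" where
  "gauss_density x = (1 / sqrt (2 * pi)) ^ d * exp (- (norm x)\<^sup>2 / 2)"

lemma gauss_density_pos: "gauss_density x > 0"
  by (simp add: gauss_density_def)

lemma gauss_density_measurable [measurable]: "gauss_density \<in> borel_measurable borel"
  unfolding gauss_density_def by measurable

lemma gauss_density_T: "(\<Prod>b\<in>B. std_normal_density (x b)) = gauss_density (T x)"
  by (simp add: std_normal_density_def gauss_density_def norm_T prod.distrib card_B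
      exp_sum[symmetric] sum_divide_distrib sum_negf power_one_over prod_dividef del: prod_constant)
    (simp add: card_B power_one_over)

lemma T_measurable_std_normal: "T \<in> (\<Pi>\<^sub>M b\<in>B. std_normal_distribution) \<rightarrow>\<^sub>M borel"
  by (rule T_measurable) simp

lemma PiM_std_normal: "(\<Pi>\<^sub>M b\<in>B. std_normal_distribution) = density P (\<lambda>x. ennreal (gauss_density (T x)))"
proof -
  interpret N: product_sigma_finite "\<lambda>_::'a. std_normal_distribution"
    by (intro product_sigma_finite.intro prob_space_imp_sigma_finite prob_space_normal_density zero_less_one)
  have "density P (\<lambda>x. ennreal (gauss_density (T x))) = (\<Pi>\<^sub>M b\<in>B. std_normal_distribution)"
  proof (rule N.PiM_eqI)
    show "sets (density P (\<lambda>x. ennreal (gauss_density (T x)))) = sets (\<Pi>\<^sub>M b\<in>B. std_normal_distribution)"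
      by (simp cong: sets_PiM_cong)
    fix A :: "'a \<Rightarrow> real set" assume A: "\<And>i. i \<in> B \<Longrightarrow> A i \<in> sets std_normal_distribution"
    then have [measurable]: "Pi\<^sub>E B A \<in> sets P" by (intro sets_PiM_I_finite) auto
    have ind: "indicator (Pi\<^sub>E B A) x = (\<Prod>b\<in>B. indicator (A b) (x b) :: ennreal)" if "x \<in> space P" for x
      using that by (auto simp: indicator_def space_PiM PiE_iff prod.neutral prod_zero)
    have "emeasure (density P (\<lambda>x. ennreal (gauss_density (T x)))) (Pi\<^sub>E B A)
        = (\<integral>\<^sup>+ x. ennreal (gauss_density (T x)) * indicator (Pi\<^sub>E B A) x \<partial>P)"
      by (rule emeasure_density) measurable
    also have "\<dots> = (\<integral>\<^sup>+ x. (\<Prod>b\<in>B. ennreal (std_normal_density (x b)) * indicator (A b) (x b)) \<partial>P)"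
      by (intro nn_integral_cong) (simp add: ind prod.distrib prod_ennreal gauss_density_T)
    also have "\<dots> = (\<Prod>b\<in>B. \<integral>\<^sup>+ y. ennreal (std_normal_density y) * indicator (A b) y \<partial>lborel)"
      using A by (intro P.product_nn_integral_prod) auto
    also have "\<dots> = (\<Prod>b\<in>B. emeasure std_normal_distribution (A b))"
      using A by (intro prod.cong refl) (simp add: emeasure_density)
    finally show "emeasure (density P (\<lambda>x. ennreal (gauss_density (T x)))) (Pi\<^sub>E B A)
        = (\<Prod>b\<in>B. emeasure std_normal_distribution (A b))" .
  qed simp
  then show ?thesis ..
qed

text \<open>Both descriptions are used: the density for changes of variables (translation, scaling,
  rotation), the independent coordinates for the law of a linear functional.\<close>

lemma gauss_eq: "gauss = density L (\<lambda>x. ennreal (gauss_density x))"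
  unfolding gauss_def PiM_std_normal L_eq by (subst density_distr) auto

lemma sets_gauss [simp, measurable_cong]: "sets gauss = sets borel"
  by (simp add: gauss_def)

lemma space_gauss [simp]: "space gauss = UNIV"
  by (simp add: gauss_def)

sublocale gauss: prob_space gauss
  unfolding gauss_def
  by (intro prob_space.prob_space_distr prob_space_PiM prob_space_normal_density T_measurable_std_normal zero_less_one)

lemma AE_gauss_in: "AE x in gauss. x \<in> E"
  unfolding gauss_eq by (subst AE_density) (auto intro: AE_mp[OF AE_L_in])

lemma nn_integral_gauss:
  assumes [measurable]: "f \<in> borel_measurable borel"
  shows "(\<integral>\<^sup>+ x. f x \<partial>gauss) = (\<integral>\<^sup>+ x. ennreal (gauss_density x) * f x \<partial>L)"
  unfolding gauss_eq by (subst nn_integral_density) auto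

lemma nn_integral_gauss_density: "(\<integral>\<^sup>+ x. ennreal (gauss_density x) \<partial>L) = 1"
  using nn_integral_gauss[of "\<lambda>_. 1"] gauss.emeasure_space_1 by simp

text \<open>Completing the square: tilting the density by \<open>exp (v \<bullet> y)\<close>
  recentres it at \<open>v\<close>, up to the constant on the right. Membership of \<open>v\<close>
  in \<open>E\<close> makes this recentring a translation that preserves \<open>L\<close>.\<close>

lemma gauss_exp_inner:
  assumes v: "v \<in> E"
  shows "(\<integral>\<^sup>+ y. ennreal (exp (v \<bullet> y)) \<partial>gauss) = ennreal (exp ((norm v)\<^sup>2 / 2))"
proof -
  have "- v \<in> E" using v subspace by (simp add: subspace_neg)
  have *: "gauss_density y * exp (v \<bullet> y) = exp ((norm v)\<^sup>2 / 2) * gauss_density (y + - v)" for y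
    by (simp add: gauss_density_def exp_add[symmetric] power2_norm_eq_inner inner_diff_left inner_diff_right
        inner_commute field_simps)
  have "(\<integral>\<^sup>+ y. ennreal (exp (v \<bullet> y)) \<partial>gauss) = (\<integral>\<^sup>+ y. ennreal (exp ((norm v)\<^sup>2 / 2)) * ennreal (gauss_density (y + - v)) \<partial>L)"
    using gauss_density_pos
    by (subst nn_integral_gauss) (auto intro!: nn_integral_cong simp: ennreal_mult[symmetric] less_imp_le * simp del: add_uminus_conv_diff)
  also have "\<dots> = ennreal (exp ((norm v)\<^sup>2 / 2)) * (\<integral>\<^sup>+ y. ennreal (gauss_density (y + - v)) \<partial>L)"
    by (rule nn_integral_cmult) measurable
  also have "(\<integral>\<^sup>+ y. ennreal (gauss_density (y + - v)) \<partial>L) = (\<integral>\<^sup>+ y. ennreal (gauss_density y) \<partial>L)"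
    using \<open>- v \<in> E\<close> by (rule nn_integral_L_translate) measurable
  finally show ?thesis by (simp add: nn_integral_gauss_density)
qed

text \<open>Substituting \<open>r *\<^sub>R x\<close> with \<open>r\<^sup>2 * (1 - s) = 1\<close>
  absorbs the exponential into the density; the Jacobian \<open>r ^ d\<close> is the value.\<close>

lemma gauss_exp_norm_square:
  assumes s: "s < 1"
  shows "(\<integral>\<^sup>+ x. ennreal (exp (s * (norm x)\<^sup>2 / 2)) \<partial>gauss) = ennreal ((1 / sqrt (1 - s)) ^ d)"
proof -
  define r where "r = 1 / sqrt (1 - s)"
  have r: "r > 0" using s by (simp add: r_def)
  have r2: "r\<^sup>2 * (1 - s) = 1" using s by (simp add: r_def power_divide)
  have *: "gauss_density (r *\<^sub>R x) * exp (s * (norm (r *\<^sub>R x))\<^sup>2 / 2) = gauss_density x" for x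
  proof -
    have "- (norm (r *\<^sub>R x))\<^sup>2 / 2 + s * (norm (r *\<^sub>R x))\<^sup>2 / 2 = - (r\<^sup>2 * (1 - s)) * (norm x)\<^sup>2 / 2"
      by (simp add: power_mult_distrib field_simps)
    also have "\<dots> = - (norm x)\<^sup>2 / 2" by (simp add: r2)
    finally show ?thesis by (simp add: gauss_density_def exp_add[symmetric])
  qed
  have "(\<integral>\<^sup>+ x. ennreal (exp (s * (norm x)\<^sup>2 / 2)) \<partial>gauss)
      = (\<integral>\<^sup>+ x. ennreal (gauss_density x * exp (s * (norm x)\<^sup>2 / 2)) \<partial>L)"
    using gauss_density_pos
    by (subst nn_integral_gauss) (auto intro!: nn_integral_cong simp: ennreal_mult[symmetric] less_imp_le)
  also have "\<dots> = ennreal (r ^ d) * (\<integral>\<^sup>+ x. ennreal (gauss_density (r *\<^sub>R x) * exp (s * (norm (r *\<^sub>R x))\<^sup>2 / 2)) \<partial>L)"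
    by (rule nn_integral_L_scale[OF r]) measurable
  also have "\<dots> = ennreal (r ^ d)"
    by (simp only: * nn_integral_gauss_density mult_1_right)
  finally show ?thesis by (simp add: r_def)
qed

section \<open>From the Gaussian measure to the uniform measure on the sphere\<close>

text \<open>The superlevel sets of the Gaussian weight are balls of radius
  \<open>sqrt (- 2 * ln t)\<close>, and homogeneity reduces the part of a cone in each of them to
  its part in the unit ball. The radial factor is thus the same for all cones
  \<open>C\<close>.\<close>

lemma nn_integral_L_layer_cake:
  assumes [measurable]: "C \<in> sets borel" and C: "\<And>r x. r > 0 \<Longrightarrow> r *\<^sub>R x \<in> C \<longleftrightarrow> x \<in> C"
  shows "(\<integral>\<^sup>+ x. ennreal (exp (- (norm x)\<^sup>2 / 2)) * indicator C x \<partial>L)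
       = (\<integral>\<^sup>+ t. indicator {0<..<1} t * ennreal (sqrt (- 2 * ln t) ^ d) \<partial>lborel) * emeasure L (C \<inter> ball 0 1)"
proof -
  interpret LL: pair_sigma_finite lborel L by standard
  define \<rho> :: "real \<Rightarrow> real" where "\<rho> t = sqrt (- 2 * ln t)" for t
  have "(\<integral>\<^sup>+ x. ennreal (exp (- (norm x)\<^sup>2 / 2)) * indicator C x \<partial>L)
      = (\<integral>\<^sup>+ x. (\<integral>\<^sup>+ t. indicator {0<..<exp (- (norm x)\<^sup>2 / 2)} t * indicator C x \<partial>lborel) \<partial>L)"
    by (intro nn_integral_cong) (simp add: nn_integral_multc)
  also have "\<dots> = (\<integral>\<^sup>+ x. (\<integral>\<^sup>+ t. (if 0 < t \<and> t < exp (- (norm x)\<^sup>2 / 2) then indicator C x else 0) \<partial>lborel) \<partial>L)"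
    by (intro nn_integral_cong) (auto split: split_indicator)
  also have "\<dots> = (\<integral>\<^sup>+ t. (\<integral>\<^sup>+ x. (if 0 < t \<and> t < exp (- (norm x)\<^sup>2 / 2) then indicator C x else 0) \<partial>L) \<partial>lborel)"
    by (rule LL.Fubini') measurable
  also have "\<dots> = (\<integral>\<^sup>+ t. indicator {0<..<1} t * ennreal (\<rho> t ^ d) * emeasure L (C \<inter> ball 0 1) \<partial>lborel)"
  proof (intro nn_integral_cong)
    fix t :: real
    show "(\<integral>\<^sup>+ x. (if 0 < t \<and> t < exp (- (norm x)\<^sup>2 / 2) then indicator C x else 0) \<partial>L)
        = indicator {0<..<1} t * ennreal (\<rho> t ^ d) * emeasure L (C \<inter> ball 0 1)"
    proof (cases "0 < t \<and> t < 1")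
      case True
      then have \<rho>: "\<rho> t > 0" by (simp add: \<rho>_def)
      have iff: "t < exp (- (norm x)\<^sup>2 / 2) \<longleftrightarrow> norm x < \<rho> t" for x :: 'a
      proof -
        have "t < exp (- (norm x)\<^sup>2 / 2) \<longleftrightarrow> ln t < - (norm x)\<^sup>2 / 2"
          using True by (metis exp_gt_zero ln_exp ln_less_cancel_iff)
        also have "\<dots> \<longleftrightarrow> (norm x)\<^sup>2 < - 2 * ln t" by auto
        also have "\<dots> \<longleftrightarrow> norm x < \<rho> t"
          unfolding \<rho>_def using real_sqrt_less_iff[of "(norm x)\<^sup>2" "- 2 * ln t"] by simp
        finally show ?thesis .
      qed
      have "(\<integral>\<^sup>+ x. (if 0 < t \<and> t < exp (- (norm x)\<^sup>2 / 2) then indicator C x else 0) \<partial>L)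
          = (\<integral>\<^sup>+ x. (if norm x < \<rho> t then indicator C x else 0) \<partial>L)"
        using True by (simp only: iff simp_thms)
      also have "\<dots> = ennreal (\<rho> t ^ d) * (\<integral>\<^sup>+ x. (if norm (\<rho> t *\<^sub>R x) < \<rho> t then indicator C (\<rho> t *\<^sub>R x) else 0) \<partial>L)"
        by (rule nn_integral_L_scale[OF \<rho>]) measurable
      also have "(\<integral>\<^sup>+ x. (if norm (\<rho> t *\<^sub>R x) < \<rho> t then indicator C (\<rho> t *\<^sub>R x) else 0) \<partial>L)
          = (\<integral>\<^sup>+ x. indicator (C \<inter> ball 0 1) x \<partial>L)"
        using \<rho> by (intro nn_integral_cong) (auto simp: C split: split_indicator)
      also have "\<dots> = emeasure L (C \<inter> ball 0 1)"
        by (rule nn_integral_indicator) (simp add: sets.Int)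
      finally show ?thesis using True by simp
    next
      case False
      have "exp (- (norm x)\<^sup>2 / 2) \<le> 1" for x :: 'a by simp
      then have "\<not> (0 < t \<and> t < exp (- (norm x)\<^sup>2 / 2))" for x :: 'a
        using False by (meson order_less_le_trans)
      then show ?thesis using False by (auto simp: indicator_def)
    qed
  qed
  also have "\<dots> = (\<integral>\<^sup>+ t. indicator {0<..<1} t * ennreal (\<rho> t ^ d) \<partial>lborel) * emeasure L (C \<inter> ball 0 1)"
    unfolding \<rho>_def by (rule nn_integral_multc) measurable
  finally show ?thesis by (simp add: \<rho>_def)
qed

text \<open>Preimages under \<open>sgn\<close> are invariant under positive scaling, and on such
  cones the Gaussian measure is proportional to the mass of \<open>L\<close> in the unit ball, which
  is how the uniform measure was defined.\<close>

lemma uniform_unit_sphere_eq: "uniform_unit_sphere E = distr gauss borel sgn"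
proof -
  have sgn_meas [measurable]: "(sgn :: 'a \<Rightarrow> 'a) \<in> borel_measurable borel"
    unfolding sgn_div_norm[abs_def] by measurable
  define \<kappa> where "\<kappa> = ennreal ((1 / sqrt (2 * pi)) ^ d) *
    (\<integral>\<^sup>+ t. indicator {0<..<1} t * ennreal (sqrt (- 2 * ln t) ^ d) \<partial>lborel)"
  have cone: "emeasure gauss C = \<kappa> * emeasure L (C \<inter> ball 0 1)"
    if [measurable]: "C \<in> sets borel" and C: "\<And>r x. r > 0 \<Longrightarrow> r *\<^sub>R x \<in> C \<longleftrightarrow> x \<in> C" for C
  proof -
    have "emeasure gauss C = (\<integral>\<^sup>+ x. ennreal ((1 / sqrt (2 * pi)) ^ d) * (ennreal (exp (- (norm x)\<^sup>2 / 2)) * indicator C x) \<partial>L)"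
      unfolding gauss_eq gauss_density_def by (subst emeasure_density) (auto simp: ennreal_mult mult.assoc)
    also have "\<dots> = \<kappa> * emeasure L (C \<inter> ball 0 1)"
      unfolding \<kappa>_def by (subst nn_integral_cmult) (simp_all only: nn_integral_L_layer_cake[OF that] mult.assoc, measurable)
    finally show ?thesis .
  qed
  define V where "V = emeasure L (ball 0 1)"
  have V: "V \<noteq> 0" "V \<noteq> \<infinity>" using emeasure_L_unit_ball by (auto simp: V_def)
  \<comment> \<open>The cone \<open>UNIV\<close> fixes the constant of proportionality, so the
    radial integral never has to be evaluated.\<close>
  have "\<kappa> * V = 1"
    using cone[of UNIV] gauss.emeasure_space_1 by (simp add: V_def)
  then have \<kappa>: "\<kappa> = 1 / V"
    using V by (metis ennreal_times_divide mult.right_neutral ennreal_divide_self infinity_ennreal_def top.not_eq_extremum)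
  show ?thesis
  proof (rule measure_eqI)
    fix A assume "A \<in> sets (uniform_unit_sphere E)"
    then have A [measurable]: "A \<in> sets borel" by (simp add: uniform_unit_sphere_def)
    have [measurable]: "sgn -` A \<in> sets borel" using measurable_sets[OF sgn_meas A] by simp
    have "emeasure (uniform_unit_sphere E) A = emeasure (uniform_measure L (ball 0 1)) (sgn -` A)"
      unfolding uniform_unit_sphere_def by (subst emeasure_distr) (auto cong: measurable_cong_sets)
    also have "\<dots> = emeasure L (ball 0 1 \<inter> sgn -` A) / V"
      unfolding V_def by (rule emeasure_uniform_measure) auto
    also have "\<dots> = \<kappa> * emeasure L (sgn -` A \<inter> ball 0 1)"
      by (simp add: \<kappa> Int_commute divide_ennreal_def mult.commute)
    also have "\<dots> = emeasure gauss (sgn -` A)"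
      by (rule cone[symmetric]) (auto simp: sgn_scaleR)
    also have "\<dots> = emeasure (distr gauss borel sgn) A"
      by (subst emeasure_distr) auto
    finally show "emeasure (uniform_unit_sphere E) A = emeasure (distr gauss borel sgn) A" .
  qed (simp add: uniform_unit_sphere_def)
qed

section \<open>Rotation invariance of a pair of independent Gaussian vectors\<close>

lemma nn_integral_L_swap:
  assumes g: "g \<in> borel_measurable (borel \<Otimes>\<^sub>M borel)"
  shows "(\<integral>\<^sup>+ x. \<integral>\<^sup>+ y. g (x, y) \<partial>L \<partial>L) = (\<integral>\<^sup>+ y. \<integral>\<^sup>+ x. g (x, y) \<partial>L \<partial>L)"
proof -
  interpret LL: pair_sigma_finite L L by standard
  have "(\<lambda>(x, y). g (x, y)) \<in> borel_measurable (L \<Otimes>\<^sub>M L)"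
    using g by (simp cong: measurable_cong_sets sets_pair_measure_cong)
  then show ?thesis by (rule LL.Fubini'[symmetric])
qed

lemma nn_integral_L_shear1:
  assumes g [measurable]: "g \<in> borel_measurable (borel \<Otimes>\<^sub>M borel)"
  shows "(\<integral>\<^sup>+ x. \<integral>\<^sup>+ y. g (x + p *\<^sub>R y, y) \<partial>L \<partial>L) = (\<integral>\<^sup>+ x. \<integral>\<^sup>+ y. g (x, y) \<partial>L \<partial>L)"
proof -
  have "(\<lambda>(x, y). g (x + p *\<^sub>R y, y)) \<in> borel_measurable (borel \<Otimes>\<^sub>M borel)" by measurable
  from nn_integral_L_swap[OF this]
  have "(\<integral>\<^sup>+ x. \<integral>\<^sup>+ y. g (x + p *\<^sub>R y, y) \<partial>L \<partial>L) = (\<integral>\<^sup>+ y. \<integral>\<^sup>+ x. g (x + p *\<^sub>R y, y) \<partial>L \<partial>L)"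
    by (simp only: case_prod_conv)
  also have "\<dots> = (\<integral>\<^sup>+ y. \<integral>\<^sup>+ x. g (x, y) \<partial>L \<partial>L)"
  proof (rule nn_integral_cong_AE, rule AE_mp[OF AE_L_in], rule AE_I2, rule impI)
    fix y assume "y \<in> E"
    then have "p *\<^sub>R y \<in> E" by (rule subspace_scale[OF subspace])
    then show "(\<integral>\<^sup>+ x. g (x + p *\<^sub>R y, y) \<partial>L) = (\<integral>\<^sup>+ x. g (x, y) \<partial>L)"
      by (rule nn_integral_L_translate[where f = "\<lambda>x. g (x, y)"]) measurable
  qed
  also have "\<dots> = (\<integral>\<^sup>+ x. \<integral>\<^sup>+ y. g (x, y) \<partial>L \<partial>L)"
    by (rule nn_integral_L_swap[OF g, symmetric])
  finally show ?thesis .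
qed

lemma nn_integral_L_shear2:
  assumes g [measurable]: "g \<in> borel_measurable (borel \<Otimes>\<^sub>M borel)"
  shows "(\<integral>\<^sup>+ x. \<integral>\<^sup>+ y. g (x, y + q *\<^sub>R x) \<partial>L \<partial>L) = (\<integral>\<^sup>+ x. \<integral>\<^sup>+ y. g (x, y) \<partial>L \<partial>L)"
proof (rule nn_integral_cong_AE, rule AE_mp[OF AE_L_in], rule AE_I2, rule impI)
  fix x assume "x \<in> E"
  then have "q *\<^sub>R x \<in> E" by (rule subspace_scale[OF subspace])
  then show "(\<integral>\<^sup>+ y. g (x, y + q *\<^sub>R x) \<partial>L) = (\<integral>\<^sup>+ y. g (x, y) \<partial>L)"
    by (rule nn_integral_L_translate[where f = "\<lambda>y. g (x, y)"]) measurable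
qed

text \<open>A plane rotation is a product of three shears, which preserve the product measure by translation invariance.\<close>

lemma nn_integral_L_rotate:
  assumes g [measurable]: "g \<in> borel_measurable (borel \<Otimes>\<^sub>M borel)"
    and cs: "c\<^sup>2 + s\<^sup>2 = (1::real)" and s: "s \<noteq> 0"
  shows "(\<integral>\<^sup>+ x. \<integral>\<^sup>+ y. g (c *\<^sub>R x + s *\<^sub>R y, c *\<^sub>R y - s *\<^sub>R x) \<partial>L \<partial>L) = (\<integral>\<^sup>+ x. \<integral>\<^sup>+ y. g (x, y) \<partial>L \<partial>L)"
proof -
  \<comment> \<open>For \<open>c = cos \<theta>\<close> and \<open>s = sin \<theta>\<close> this is
    the tangent of half the angle: the rotation is the shear by \<open>p\<close>, then by
    \<open>- s\<close>, then by \<open>p\<close> again. The division is why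
    \<open>s \<noteq> 0\<close> is assumed.\<close>
  define p where "p = (1 - c) / s"
  have ps: "1 - p * s = c" using s by (simp add: p_def)
  have pc: "p + p * c = s" using cs s by (simp add: p_def field_simps power2_eq_square)
  define g1 where "g1 = (\<lambda>(x, y). g (x + p *\<^sub>R y, y))"
  define g2 where "g2 = (\<lambda>(x, y). g1 (x, y + (- s) *\<^sub>R x))"
  have m1 [measurable]: "g1 \<in> borel_measurable (borel \<Otimes>\<^sub>M borel)"
    unfolding g1_def by measurable
  have m2 [measurable]: "g2 \<in> borel_measurable (borel \<Otimes>\<^sub>M borel)"
    unfolding g2_def by measurable
  have "g2 (x + p *\<^sub>R y, y) = g (c *\<^sub>R x + s *\<^sub>R y, c *\<^sub>R y - s *\<^sub>R x)" for x y
  proof -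
    have "x + p *\<^sub>R y + p *\<^sub>R (y + (- s) *\<^sub>R (x + p *\<^sub>R y)) = (1 - p * s) *\<^sub>R x + (p *\<^sub>R y + (p * (1 - p * s)) *\<^sub>R y)"
      by (simp add: algebra_simps)
    moreover have "y + (- s) *\<^sub>R (x + p *\<^sub>R y) = (1 - p * s) *\<^sub>R y - s *\<^sub>R x"
      by (simp add: algebra_simps)
    ultimately show ?thesis by (simp only: g2_def g1_def ps pc scaleR_add_left[symmetric] case_prod_conv)
  qed
  then have "(\<integral>\<^sup>+ x. \<integral>\<^sup>+ y. g (c *\<^sub>R x + s *\<^sub>R y, c *\<^sub>R y - s *\<^sub>R x) \<partial>L \<partial>L)
      = (\<integral>\<^sup>+ x. \<integral>\<^sup>+ y. g2 (x + p *\<^sub>R y, y) \<partial>L \<partial>L)"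
    by simp
  also have "\<dots> = (\<integral>\<^sup>+ x. \<integral>\<^sup>+ y. g1 (x, y + (- s) *\<^sub>R x) \<partial>L \<partial>L)"
    by (subst nn_integral_L_shear1[OF m2]) (simp only: g2_def case_prod_conv)
  also have "\<dots> = (\<integral>\<^sup>+ x. \<integral>\<^sup>+ y. g1 (x, y) \<partial>L \<partial>L)"
    by (rule nn_integral_L_shear2[OF m1])
  also have "\<dots> = (\<integral>\<^sup>+ x. \<integral>\<^sup>+ y. g (x, y) \<partial>L \<partial>L)"
    unfolding g1_def case_prod_conv by (rule nn_integral_L_shear1[OF g])
  finally show ?thesis .
qed

lemma nn_integral_gauss_gauss:
  assumes [measurable]: "g \<in> borel_measurable (borel \<Otimes>\<^sub>M borel)"
  shows "(\<integral>\<^sup>+ x. \<integral>\<^sup>+ y. g (x, y) \<partial>gauss \<partial>gauss)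
    = (\<integral>\<^sup>+ x. \<integral>\<^sup>+ y. ennreal (gauss_density x * gauss_density y) * g (x, y) \<partial>L \<partial>L)"
proof -
  have "(\<integral>\<^sup>+ x. \<integral>\<^sup>+ y. g (x, y) \<partial>gauss \<partial>gauss)
      = (\<integral>\<^sup>+ x. ennreal (gauss_density x) * \<integral>\<^sup>+ y. ennreal (gauss_density y) * g (x, y) \<partial>L \<partial>L)"
    by (simp add: nn_integral_gauss)
  also have "\<dots> = (\<integral>\<^sup>+ x. \<integral>\<^sup>+ y. ennreal (gauss_density x) * (ennreal (gauss_density y) * g (x, y)) \<partial>L \<partial>L)"
    by (intro nn_integral_cong nn_integral_cmult[symmetric]) measurable
  also have "\<dots> = (\<integral>\<^sup>+ x. \<integral>\<^sup>+ y. ennreal (gauss_density x * gauss_density y) * g (x, y) \<partial>L \<partial>L)"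
    using gauss_density_pos by (intro nn_integral_cong) (simp add: ennreal_mult less_imp_le mult.assoc)
  finally show ?thesis .
qed

text \<open>The product density depends only on \<open>(norm x)\<^sup>2 + (norm y)\<^sup>2\<close>,
  which the rotation preserves, so the invariance of Lebesgue measure carries over.\<close>

lemma gauss_rotate:
  assumes [measurable]: "g \<in> borel_measurable (borel \<Otimes>\<^sub>M borel)"
    and cs: "c\<^sup>2 + s\<^sup>2 = (1::real)" and s: "s \<noteq> 0"
  shows "(\<integral>\<^sup>+ x. \<integral>\<^sup>+ y. g (c *\<^sub>R x + s *\<^sub>R y, c *\<^sub>R y - s *\<^sub>R x) \<partial>gauss \<partial>gauss)
    = (\<integral>\<^sup>+ x. \<integral>\<^sup>+ y. g (x, y) \<partial>gauss \<partial>gauss)"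
proof -
  have dens: "gauss_density (c *\<^sub>R x + s *\<^sub>R y) * gauss_density (c *\<^sub>R y - s *\<^sub>R x) = gauss_density x * gauss_density y" for x y
  proof -
    have "(norm (c *\<^sub>R x + s *\<^sub>R y))\<^sup>2 + (norm (c *\<^sub>R y - s *\<^sub>R x))\<^sup>2 = (c\<^sup>2 + s\<^sup>2) * ((norm x)\<^sup>2 + (norm y)\<^sup>2)"
      by (simp only: power2_norm_eq_inner inner_add_left inner_add_right inner_diff_left inner_diff_right
          inner_scaleR_left inner_scaleR_right inner_commute[of y x]) (simp add: power2_eq_square algebra_simps)
    then have "- (norm (c *\<^sub>R x + s *\<^sub>R y))\<^sup>2 / 2 + - (norm (c *\<^sub>R y - s *\<^sub>R x))\<^sup>2 / 2 = - (norm x)\<^sup>2 / 2 + - (norm y)\<^sup>2 / 2"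
      by (simp add: cs field_simps)
    then have "exp (- (norm (c *\<^sub>R x + s *\<^sub>R y))\<^sup>2 / 2) * exp (- (norm (c *\<^sub>R y - s *\<^sub>R x))\<^sup>2 / 2)
        = exp (- (norm x)\<^sup>2 / 2) * exp (- (norm y)\<^sup>2 / 2)"
      by (simp only: exp_add[symmetric])
    then show ?thesis by (simp only: gauss_density_def mult_ac)
  qed
  have "(\<integral>\<^sup>+ x. \<integral>\<^sup>+ y. g (c *\<^sub>R x + s *\<^sub>R y, c *\<^sub>R y - s *\<^sub>R x) \<partial>gauss \<partial>gauss)
      = (\<integral>\<^sup>+ x. \<integral>\<^sup>+ y. ennreal (gauss_density x * gauss_density y) * g (c *\<^sub>R x + s *\<^sub>R y, c *\<^sub>R y - s *\<^sub>R x) \<partial>L \<partial>L)"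
    by (rule nn_integral_gauss_gauss[of "\<lambda>(x, y). g (c *\<^sub>R x + s *\<^sub>R y, c *\<^sub>R y - s *\<^sub>R x)", unfolded case_prod_conv]) measurable
  also have "\<dots> = (\<integral>\<^sup>+ x. \<integral>\<^sup>+ y. ennreal (gauss_density (c *\<^sub>R x + s *\<^sub>R y) * gauss_density (c *\<^sub>R y - s *\<^sub>R x)) *
      g (c *\<^sub>R x + s *\<^sub>R y, c *\<^sub>R y - s *\<^sub>R x) \<partial>L \<partial>L)"
    by (simp only: dens)
  also have "\<dots> = (\<integral>\<^sup>+ x. \<integral>\<^sup>+ y. ennreal (gauss_density x * gauss_density y) * g (x, y) \<partial>L \<partial>L)"
    by (rule nn_integral_L_rotate[of "\<lambda>(x, y). ennreal (gauss_density x * gauss_density y) * g (x, y)", OF _ cs s, unfolded case_prod_conv]) measurable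
  also have "\<dots> = (\<integral>\<^sup>+ x. \<integral>\<^sup>+ y. g (x, y) \<partial>gauss \<partial>gauss)"
    by (rule nn_integral_gauss_gauss[of g, symmetric]) measurable
  finally show ?thesis .
qed

text \<open>In coordinates \<open>x \<bullet> a\<close> is a sum of independent centred normal
  variables with standard deviations \<open>\<bar>b \<bullet> a\<bar>\<close>, whose squares add up
  to \<open>(norm a)\<^sup>2 = 1\<close>.\<close>

lemma distr_gauss_inner:
  assumes a: "a \<in> E" "norm a = 1"
  shows "distr gauss borel (\<lambda>x. x \<bullet> a) = std_normal_distribution"
proof -
  let ?N = "\<Pi>\<^sub>M b\<in>B. std_normal_distribution"
  have ps: "prob_space std_normal_distribution" by (rule prob_space_normal_density) simp
  interpret N: prob_space ?N by (intro prob_space_PiM ps)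
  \<comment> \<open>A zero coefficient would give a point mass, which has no normal density; such
    terms are dropped before the normal variables are summed.\<close>
  define J where "J = {b \<in> B. b \<bullet> a \<noteq> 0}"
  have finJ: "finite J" by (simp add: J_def)
  have sumsq: "(\<Sum>b\<in>J. (\<bar>b \<bullet> a\<bar> * 1)\<^sup>2) = 1"
  proof -
    have "(\<Sum>b\<in>J. (\<bar>b \<bullet> a\<bar> * 1)\<^sup>2) = (\<Sum>b\<in>B. (b \<bullet> a)\<^sup>2)"
      unfolding J_def by (intro sum.mono_neutral_cong_left) auto
    then show ?thesis using norm_eq_sum_B[OF a(1)] a(2) by simp
  qed
  have Jne: "J \<noteq> {}" using sumsq by auto
  have comp: "distr ?N borel (\<lambda>\<omega>. \<omega> b) = std_normal_distribution" if "b \<in> B" for b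
  proof -
    have "distr ?N borel (\<lambda>\<omega>. \<omega> b) = distr ?N std_normal_distribution (\<lambda>\<omega>. \<omega> b)"
      by (intro distr_cong) auto
    also have "\<dots> = std_normal_distribution" by (rule distr_PiM_component[OF ps that])
    finally show ?thesis .
  qed
  have rv: "(\<lambda>\<omega>. \<omega> b) \<in> ?N \<rightarrow>\<^sub>M borel" if "b \<in> B" for b
    using measurable_component_singleton[OF that, of "\<lambda>_. std_normal_distribution"] by (simp cong: measurable_cong_sets)
  have "N.indep_vars (\<lambda>_. borel) (\<lambda>b \<omega>. \<omega> b) B"
  proof (subst N.indep_vars_iff_distr_eq_PiM')
    show "B \<noteq> {}" using Jne by (auto simp: J_def)
    have "distr ?N (\<Pi>\<^sub>M i\<in>B. borel) (\<lambda>x. \<lambda>i\<in>B. x i) = distr ?N ?N (\<lambda>x. x)"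
      by (intro distr_cong sets_PiM_cong) (auto simp: space_PiM PiE_iff extensional_restrict cong: sets_PiM_cong)
    also have "\<dots> = (\<Pi>\<^sub>M i\<in>B. distr ?N borel (\<lambda>\<omega>. \<omega> i))"
      unfolding distr_id2[OF refl] by (intro PiM_cong refl comp[symmetric])
    finally show "distr ?N (\<Pi>\<^sub>M i\<in>B. borel) (\<lambda>x. \<lambda>i\<in>B. x i) = (\<Pi>\<^sub>M i\<in>B. distr ?N borel (\<lambda>\<omega>. \<omega> i))" .
  qed (rule rv)
  then have "N.indep_vars (\<lambda>_. borel) (\<lambda>b \<omega>. \<omega> b) J"
    by (rule N.indep_vars_subset) (auto simp: J_def)
  then have ind: "N.indep_vars (\<lambda>_. borel) (\<lambda>b \<omega>. 0 + (b \<bullet> a) * \<omega> b) J"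
    by (rule N.indep_vars_compose2[where Y = "\<lambda>b x. 0 + (b \<bullet> a) * x" and X = "\<lambda>b \<omega>. \<omega> b"]) simp
  have norm: "distributed ?N lborel (\<lambda>\<omega>. 0 + (b \<bullet> a) * \<omega> b) (normal_density (0 + (b \<bullet> a) * 0) (\<bar>b \<bullet> a\<bar> * 1))" if "b \<in> J" for b
  proof (rule N.normal_density_affine[of "\<lambda>\<omega>. \<omega> b" 0 1 "b \<bullet> a" 0])
    have "distr ?N lborel (\<lambda>\<omega>. \<omega> b) = distr ?N borel (\<lambda>\<omega>. \<omega> b)"
      by (rule distr_cong) simp_all
    also have "\<dots> = density lborel std_normal_density"
      using that by (intro comp) (simp add: J_def)
    finally have "distr ?N lborel (\<lambda>\<omega>. \<omega> b) = density lborel std_normal_density" .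
    then show "distributed ?N lborel (\<lambda>\<omega>. \<omega> b) (normal_density 0 1)"
      using rv[of b] that by (simp add: distributed_def J_def)
  qed (use that in \<open>auto simp: J_def\<close>)
  have "distributed ?N lborel (\<lambda>\<omega>. \<Sum>b\<in>J. 0 + (b \<bullet> a) * \<omega> b)
      (normal_density (\<Sum>b\<in>J. 0 + (b \<bullet> a) * 0) (sqrt (\<Sum>b\<in>J. (\<bar>b \<bullet> a\<bar> * 1)\<^sup>2)))"
    by (rule N.sum_indep_normal[OF finJ Jne ind _ norm]) (auto simp: J_def)
  then have "distributed ?N lborel (\<lambda>\<omega>. \<Sum>b\<in>J. 0 + (b \<bullet> a) * \<omega> b) std_normal_density"
    by (simp only: sumsq) simp
  then have "distr ?N lborel (\<lambda>\<omega>. \<Sum>b\<in>J. 0 + (b \<bullet> a) * \<omega> b) = std_normal_distribution"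
    by (rule distributed_distr_eq_density)
  moreover have "(\<lambda>\<omega>. \<Sum>b\<in>J. 0 + (b \<bullet> a) * \<omega> b) = (\<lambda>\<omega>. T \<omega> \<bullet> a)"
  proof
    fix \<omega>
    show "(\<Sum>b\<in>J. 0 + (b \<bullet> a) * \<omega> b) = T \<omega> \<bullet> a"
      unfolding T_inner by (rule sum.mono_neutral_cong_left) (simp_all add: J_def)
  qed
  ultimately have *: "distr ?N lborel (\<lambda>\<omega>. T \<omega> \<bullet> a) = std_normal_distribution" by (simp only:)
  have "distr gauss borel (\<lambda>x. x \<bullet> a) = distr ?N borel ((\<lambda>x. x \<bullet> a) \<circ> T)"
    unfolding gauss_def by (rule distr_distr[OF _ T_measurable_std_normal]) simp
  also have "\<dots> = distr ?N lborel (\<lambda>\<omega>. T \<omega> \<bullet> a)"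
    by (rule distr_cong) simp_all
  finally show ?thesis by (simp only: *)
qed

end

section \<open>Gaussian concentration\<close>

text \<open>Jensen's inequality: the integral of \<open>\<phi>\<close> is the average of
  \<open>(b - a) * \<phi> t\<close>, and the tangent line of \<open>exp\<close> at that average is
  integrated.\<close>

lemma exp_average_le:
  fixes \<phi> :: "real \<Rightarrow> real"
  assumes ab: "a < b" and \<phi>: "continuous_on {a..b} \<phi>"
  shows "exp (integral {a..b} \<phi>) \<le> (1 / (b - a)) * integral {a..b} (\<lambda>t. exp ((b - a) * \<phi> t))"
proof -
  define I where "I = integral {a..b} \<phi>"
  have int: "\<phi> integrable_on {a..b}" using \<phi> by (rule integrable_continuous_interval)
  have lin: "((\<lambda>t. exp I * (1 + ((b - a) * \<phi> t - I))) has_integral exp I * ((b - a) * 1 + ((b - a) * I - (b - a) * I))) {a..b}"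
    using ab has_integral_const_real[of "1::real" a b] has_integral_const_real[of I a b] integrable_integral[OF int]
    by (intro has_integral_mult_right has_integral_add has_integral_diff) (auto simp: I_def)
  have "(b - a) * exp I = integral {a..b} (\<lambda>t. exp I * (1 + ((b - a) * \<phi> t - I)))"
    using integral_unique[OF lin] by simp
  also have "\<dots> \<le> integral {a..b} (\<lambda>t. exp ((b - a) * \<phi> t))"
  proof (rule integral_le)
    show "(\<lambda>t. exp I * (1 + ((b - a) * \<phi> t - I))) integrable_on {a..b}" using lin by blast
    show "(\<lambda>t. exp ((b - a) * \<phi> t)) integrable_on {a..b}"
      by (intro integrable_continuous_interval continuous_intros \<phi>)
    fix t
    have "exp I * (1 + ((b - a) * \<phi> t - I)) \<le> exp I * exp ((b - a) * \<phi> t - I)"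
      by (intro mult_left_mono exp_ge_add_one_self) simp
    then show "exp I * (1 + ((b - a) * \<phi> t - I)) \<le> exp ((b - a) * \<phi> t)"
      by (simp add: exp_add[symmetric])
  qed
  finally show ?thesis
    using ab by (simp add: I_def field_simps)
qed

context nonzero_subspace
begin

text \<open>Gradients of functions on the ambient space need not lie in \<open>E\<close>, but the
  measure sees only their projection \<open>p\<close> onto \<open>E\<close>. Testing the hypothesis
  with \<open>p\<close> itself bounds its norm by \<open>l\<close>.\<close>

lemma gauss_exp_inner_le:
  assumes v: "\<And>h. h \<in> E \<Longrightarrow> v \<bullet> h \<le> l * norm h" and l: "l \<ge> 0"
  shows "(\<integral>\<^sup>+ y. ennreal (exp (v \<bullet> y)) \<partial>gauss) \<le> ennreal (exp (l\<^sup>2 / 2))"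
proof -
  obtain p q where p: "p \<in> E" and q: "\<And>w. w \<in> E \<Longrightarrow> orthogonal q w" and v_eq: "v = p + q"
    using orthogonal_subspace_decomp_exists[of E v] span_eq_iff[THEN iffD2, OF subspace] by metis
  have vh: "v \<bullet> h = p \<bullet> h" if "h \<in> E" for h
    using q[OF that] by (simp add: v_eq inner_add_left orthogonal_def)
  have "norm p * norm p \<le> l * norm p"
    using v[OF p] by (simp add: vh[OF p] dot_square_norm power2_eq_square)
  then have "norm p \<le> l"
    using l by (cases "norm p = 0") (auto simp: mult_le_cancel_right)
  have "(\<integral>\<^sup>+ y. ennreal (exp (v \<bullet> y)) \<partial>gauss) = (\<integral>\<^sup>+ y. ennreal (exp (p \<bullet> y)) \<partial>gauss)"
    using AE_gauss_in by (intro nn_integral_cong_AE) (auto simp: vh)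
  also have "\<dots> = ennreal (exp ((norm p)\<^sup>2 / 2))" by (rule gauss_exp_inner[OF p])
  also have "\<dots> \<le> ennreal (exp (l\<^sup>2 / 2))"
    using \<open>norm p \<le> l\<close> by (intro ennreal_leI) (simp add: power_mono)
  finally show ?thesis .
qed


text \<open>
  Maurey and Pisier: interpolating along the quarter circle \<open>t \<mapsto> cos t * x + sin t * y\<close>, the derivative
  of \<open>F\<close> is at every time distributed like \<open>\<nabla>F(x) \<bullet> y\<close>, by rotation invariance.
\<close>

lemma gauss_exp_difference_le:
  fixes F :: "'a \<Rightarrow> real" and D :: "'a \<Rightarrow> 'a"
  assumes deriv: "\<And>x. (F has_derivative (\<lambda>h. D x \<bullet> h)) (at x)"
    and cont: "continuous_on UNIV D"
    and D: "\<And>x h. D x \<bullet> h \<le> l * norm h" and l: "l \<ge> 0"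
  shows "(\<integral>\<^sup>+ x. \<integral>\<^sup>+ y. ennreal (exp (F y - F x)) \<partial>gauss \<partial>gauss) \<le> ennreal (exp (pi\<^sup>2 * l\<^sup>2 / 8))"
proof -
  interpret GL: pair_sigma_finite lborel gauss by standard
  have D_meas [measurable]: "D \<in> borel_measurable borel"
    using cont by (rule borel_measurable_continuous_onI)
  have F_cont: "continuous_on UNIV F"
    using deriv by (meson continuous_at_imp_continuous_on has_derivative_continuous)
  then have F_meas [measurable]: "F \<in> borel_measurable borel"
    by (rule borel_measurable_continuous_onI)
  \<comment> \<open>The second argument is the velocity of the quarter circle. Position and velocity
    together form the rotated pair of \<open>gauss_rotate\<close>.\<close>
  define \<phi> where "\<phi> x y t = D (cos t *\<^sub>R x + sin t *\<^sub>R y) \<bullet> (cos t *\<^sub>R y - sin t *\<^sub>R x)" for x y t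
  \<comment> \<open>The factor \<open>pi / 2\<close> is the length of the time interval, coming from
    \<open>exp_average_le\<close>.\<close>
  define g where "g = (\<lambda>(x, y). ennreal (exp (pi / 2 * (D x \<bullet> y))))"
  have g_meas [measurable]: "g \<in> borel_measurable (borel \<Otimes>\<^sub>M borel)"
    unfolding g_def by measurable
  have path: "ennreal (exp (F y - F x))
      \<le> ennreal (2 / pi) * (\<integral>\<^sup>+ t. indicator {0..pi/2} t * g (cos t *\<^sub>R x + sin t *\<^sub>R y, cos t *\<^sub>R y - sin t *\<^sub>R x) \<partial>lborel)" for x y
  proof -
    have cont_\<phi>: "continuous_on S (\<phi> x y)" for S
      unfolding \<phi>_def by (intro continuous_intros continuous_on_compose2[OF cont]) auto
    have "(\<phi> x y has_integral (F (cos (pi/2) *\<^sub>R x + sin (pi/2) *\<^sub>R y) - F (cos 0 *\<^sub>R x + sin 0 *\<^sub>R y))) {0..pi/2}"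
    proof (rule fundamental_theorem_of_calculus)
      fix t :: real
      have "((\<lambda>t. cos t *\<^sub>R x + sin t *\<^sub>R y) has_derivative (\<lambda>h. h *\<^sub>R (cos t *\<^sub>R y - sin t *\<^sub>R x))) (at t within {0..pi/2})"
        by (auto intro!: derivative_eq_intros simp: algebra_simps)
      from has_derivative_compose[OF this deriv]
      show "((\<lambda>t. F (cos t *\<^sub>R x + sin t *\<^sub>R y)) has_vector_derivative \<phi> x y t) (at t within {0..pi/2})"
        by (simp add: has_vector_derivative_def \<phi>_def)
    qed simp
    then have "integral {0..pi/2} (\<phi> x y) = F y - F x"
      by (simp add: integral_unique)
    then have "exp (F y - F x) \<le> (2 / pi) * integral {0..pi/2} (\<lambda>t. exp (pi / 2 * \<phi> x y t))"
      using exp_average_le[of 0 "pi/2" "\<phi> x y", OF _ cont_\<phi>] by simp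
    moreover have "(\<integral>\<^sup>+ t. indicator {0..pi/2} t * ennreal (exp (pi / 2 * \<phi> x y t)) \<partial>lborel)
        = ennreal (integral {0..pi/2} (\<lambda>t. exp (pi / 2 * \<phi> x y t)))"
    proof -
      have "((\<lambda>t. exp (pi / 2 * \<phi> x y t)) has_integral integral {0..pi/2} (\<lambda>t. exp (pi / 2 * \<phi> x y t))) {0..pi/2}"
        by (intro integrable_integral integrable_continuous_interval continuous_intros cont_\<phi>)
      from nn_integral_has_integral_lebesgue'[OF _ this] show ?thesis
        by (simp add: mult.commute)
    qed
    moreover have "g (cos t *\<^sub>R x + sin t *\<^sub>R y, cos t *\<^sub>R y - sin t *\<^sub>R x) = ennreal (exp (pi / 2 * \<phi> x y t))" for t
      by (simp add: g_def \<phi>_def)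
    ultimately show ?thesis
      by (simp only: ennreal_mult'[symmetric] ennreal_leI divide_nonneg_nonneg zero_le_numeral pi_ge_zero)
  qed
  \<comment> \<open>Time 0 is excluded because the rotation lemma needs
    \<open>sin t \<noteq> 0\<close>; a single point is negligible in the time integral.\<close>
  have slice: "(\<integral>\<^sup>+ x. \<integral>\<^sup>+ y. g (cos t *\<^sub>R x + sin t *\<^sub>R y, cos t *\<^sub>R y - sin t *\<^sub>R x) \<partial>gauss \<partial>gauss) \<le> ennreal (exp (pi\<^sup>2 * l\<^sup>2 / 8))"
    if "t \<in> {0<..pi/2}" for t
  proof -
    have "sin t \<noteq> 0" using that sin_gt_zero[of t] by auto
    then have "(\<integral>\<^sup>+ x. \<integral>\<^sup>+ y. g (cos t *\<^sub>R x + sin t *\<^sub>R y, cos t *\<^sub>R y - sin t *\<^sub>R x) \<partial>gauss \<partial>gauss) = (\<integral>\<^sup>+ x. \<integral>\<^sup>+ y. g (x, y) \<partial>gauss \<partial>gauss)"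
      by (intro gauss_rotate g_meas) auto
    also have "\<dots> \<le> (\<integral>\<^sup>+ x. ennreal (exp ((pi / 2 * l)\<^sup>2 / 2)) \<partial>gauss)"
    proof (rule nn_integral_mono)
      fix x
      have "(\<integral>\<^sup>+ y. ennreal (exp (((pi / 2) *\<^sub>R D x) \<bullet> y)) \<partial>gauss) \<le> ennreal (exp ((pi / 2 * l)\<^sup>2 / 2))"
        using D l by (intro gauss_exp_inner_le) auto
      then show "(\<integral>\<^sup>+ y. g (x, y) \<partial>gauss) \<le> ennreal (exp ((pi / 2 * l)\<^sup>2 / 2))"
        by (simp add: g_def)
    qed
    also have "\<dots> = ennreal (exp (pi\<^sup>2 * l\<^sup>2 / 8))"
      using gauss.emeasure_space_1 by (simp add: power_mult_distrib power_divide)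
    finally show ?thesis .
  qed
  let ?h = "\<lambda>x y t. indicator {0..pi/2} t * g (cos t *\<^sub>R x + sin t *\<^sub>R y, cos t *\<^sub>R y - sin t *\<^sub>R x)"
  have "(\<integral>\<^sup>+ x. \<integral>\<^sup>+ y. ennreal (exp (F y - F x)) \<partial>gauss \<partial>gauss)
      \<le> (\<integral>\<^sup>+ x. \<integral>\<^sup>+ y. ennreal (2 / pi) * (\<integral>\<^sup>+ t. ?h x y t \<partial>lborel) \<partial>gauss \<partial>gauss)"
    by (intro nn_integral_mono path)
  also have "\<dots> = ennreal (2 / pi) * (\<integral>\<^sup>+ x. \<integral>\<^sup>+ y. \<integral>\<^sup>+ t. ?h x y t \<partial>lborel \<partial>gauss \<partial>gauss)"
    by (subst nn_integral_cmult, measurable)+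
  also have "(\<integral>\<^sup>+ x. \<integral>\<^sup>+ y. \<integral>\<^sup>+ t. ?h x y t \<partial>lborel \<partial>gauss \<partial>gauss) = (\<integral>\<^sup>+ x. \<integral>\<^sup>+ t. \<integral>\<^sup>+ y. ?h x y t \<partial>gauss \<partial>lborel \<partial>gauss)"
  proof (rule nn_integral_cong)
    fix x
    show "(\<integral>\<^sup>+ y. \<integral>\<^sup>+ t. ?h x y t \<partial>lborel \<partial>gauss) = (\<integral>\<^sup>+ t. \<integral>\<^sup>+ y. ?h x y t \<partial>gauss \<partial>lborel)"
      by (rule GL.Fubini'[of "\<lambda>t y. ?h x y t"]) measurable
  qed
  also have "\<dots> = (\<integral>\<^sup>+ t. \<integral>\<^sup>+ x. \<integral>\<^sup>+ y. ?h x y t \<partial>gauss \<partial>gauss \<partial>lborel)"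
    by (rule GL.Fubini'[of "\<lambda>t x. \<integral>\<^sup>+ y. ?h x y t \<partial>gauss"]) measurable
  also have "\<dots> = (\<integral>\<^sup>+ t. indicator {0..pi/2} t * (\<integral>\<^sup>+ x. \<integral>\<^sup>+ y. g (cos t *\<^sub>R x + sin t *\<^sub>R y, cos t *\<^sub>R y - sin t *\<^sub>R x) \<partial>gauss \<partial>gauss) \<partial>lborel)"
    by (intro nn_integral_cong) (simp add: nn_integral_cmult)
  also have "\<dots> \<le> (\<integral>\<^sup>+ t. ennreal (exp (pi\<^sup>2 * l\<^sup>2 / 8)) * indicator {0..pi/2} t \<partial>lborel)"
  proof (rule nn_integral_mono_AE)
    show "AE t in lborel. indicator {0..pi/2} t * (\<integral>\<^sup>+ x. \<integral>\<^sup>+ y. g (cos t *\<^sub>R x + sin t *\<^sub>R y, cos t *\<^sub>R y - sin t *\<^sub>R x) \<partial>gauss \<partial>gauss)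
        \<le> ennreal (exp (pi\<^sup>2 * l\<^sup>2 / 8)) * indicator {0..pi/2} t"
      using AE_lborel_singleton[of "0::real"]
    proof eventually_elim
      case (elim t)
      then show ?case using slice[of t] by (auto split: split_indicator)
    qed
  qed
  also have "\<dots> = ennreal (exp (pi\<^sup>2 * l\<^sup>2 / 8)) * ennreal (pi / 2)"
    by (subst nn_integral_cmult_indicator) auto
  finally show ?thesis
    by (simp add: mult_left_mono ennreal_mult[symmetric])
qed

text \<open>The exponential Markov inequality after symmetrisation: an independent copy
  \<open>y\<close> replaces the mean, so that only the exponential moment of a difference is needed.
  The difference bound is applied to \<open>- k * F\<close>, whose gradient is bounded by
  \<open>k * l\<close>.\<close>

lemma gauss_concentration:
  fixes F :: "'a \<Rightarrow> real" and D :: "'a \<Rightarrow> 'a"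
  assumes deriv: "\<And>x. (F has_derivative (\<lambda>h. D x \<bullet> h)) (at x)"
    and cont: "continuous_on UNIV D"
    and D: "\<And>x h. D x \<bullet> h \<le> l * norm h" and l: "l > 0"
    and bounded: "\<And>x. \<bar>F x\<bar> \<le> C" and r: "r > 0"
  shows "measure gauss {x. F x - (\<integral>y. F y \<partial>gauss) \<ge> r} \<le> exp (- 2 * r\<^sup>2 / (pi\<^sup>2 * l\<^sup>2))"
proof -
  have "continuous_on UNIV F"
    using deriv by (meson continuous_at_imp_continuous_on has_derivative_continuous)
  then have F_meas [measurable]: "F \<in> borel_measurable borel"
    by (rule borel_measurable_continuous_onI)
  define m where "m = (\<integral>y. F y \<partial>gauss)"
  \<comment> \<open>Minimises the exponent
    \<open>- k * r + pi\<^sup>2 * (k * l)\<^sup>2 / 8\<close>.\<close>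
  define k where "k = 4 * r / (pi\<^sup>2 * l\<^sup>2)"
  have k: "k > 0" using r l by (simp add: k_def)
  have F_int: "integrable gauss F"
    using bounded by (intro gauss.integrable_const_bound[of _ C]) auto
  \<comment> \<open>A factor of at least 1 may be multiplied in freely; this is what introduces the
    independent copy.\<close>
  have jensen: "1 \<le> (\<integral>\<^sup>+ y. ennreal (exp (k * (m - F y))) \<partial>gauss)"
  proof -
    have int: "integrable gauss (\<lambda>y. exp (k * (m - F y)))"
    proof (intro gauss.integrable_const_bound[of _ "exp (k * (m + C))"] AE_I2)
      fix y
      have "m - F y \<le> m + C" using bounded[of y] by (simp add: abs_le_iff)
      then show "norm (exp (k * (m - F y))) \<le> exp (k * (m + C))" using k by simp
    qed measurable
    have "1 = (\<integral>y. 1 + k * (m - F y) \<partial>gauss)"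
      using F_int gauss.prob_space by (simp add: m_def)
    also have "\<dots> \<le> (\<integral>y. exp (k * (m - F y)) \<partial>gauss)"
      using F_int int by (intro integral_mono) auto
    finally have "ennreal 1 \<le> ennreal (\<integral>y. exp (k * (m - F y)) \<partial>gauss)" by (rule ennreal_leI)
    also have "\<dots> = (\<integral>\<^sup>+ y. ennreal (exp (k * (m - F y))) \<partial>gauss)"
      by (rule nn_integral_eq_integral[symmetric, OF int]) simp
    finally show ?thesis by simp
  qed
  have "(\<integral>\<^sup>+ x. ennreal (exp (k * (F x - m))) \<partial>gauss)
      \<le> (\<integral>\<^sup>+ x. ennreal (exp (k * (F x - m))) * (\<integral>\<^sup>+ y. ennreal (exp (k * (m - F y))) \<partial>gauss) \<partial>gauss)"
    using mult_left_mono[OF jensen] by (intro nn_integral_mono) auto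
  also have "\<dots> = (\<integral>\<^sup>+ x. \<integral>\<^sup>+ y. ennreal (exp (k * (F x - m))) * ennreal (exp (k * (m - F y))) \<partial>gauss \<partial>gauss)"
    by (intro nn_integral_cong nn_integral_cmult[symmetric]) measurable
  also have "\<dots> = (\<integral>\<^sup>+ x. \<integral>\<^sup>+ y. ennreal (exp (- k * F y - - k * F x)) \<partial>gauss \<partial>gauss)"
    by (simp add: ennreal_mult[symmetric] exp_add[symmetric] algebra_simps)
  also have "\<dots> \<le> ennreal (exp (pi\<^sup>2 * (k * l)\<^sup>2 / 8))"
  proof (rule gauss_exp_difference_le)
    show "((\<lambda>x. - k * F x) has_derivative (\<lambda>h. (- k *\<^sub>R D x) \<bullet> h)) (at x)" for x
      using has_derivative_mult_right[OF deriv, of "- k"] by simp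
    show "continuous_on UNIV (\<lambda>x. - k *\<^sub>R D x)" by (intro continuous_intros cont)
    show "(- k *\<^sub>R D x) \<bullet> h \<le> (k * l) * norm h" for x h
      using D[of x "- h"] k by (simp add: mult.assoc mult_left_mono flip: minus_mult_right)
         (metis mult_left_mono less_imp_le mult_minus_right)
  qed (use k l in simp)
  finally have mgf: "(\<integral>\<^sup>+ x. ennreal (exp (k * (F x - m))) \<partial>gauss) \<le> ennreal (exp (pi\<^sup>2 * (k * l)\<^sup>2 / 8))" .
  have "F x - m \<ge> r \<longleftrightarrow> 1 \<le> ennreal (exp (- k * r)) * ennreal (exp (k * (F x - m)))" for x
  proof -
    have "F x - m \<ge> r \<longleftrightarrow> k * (F x - m) \<ge> k * r"
      using k by simp
    then show ?thesis
      by (simp add: ennreal_mult[symmetric] exp_add[symmetric])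
  qed
  then have "{x. F x - m \<ge> r} = {x\<in>UNIV. 1 \<le> ennreal (exp (- k * r)) * ennreal (exp (k * (F x - m)))}"
    by (simp only: simp_thms UNIV_I)
  then have "emeasure gauss {x. F x - m \<ge> r}
      = emeasure gauss {x\<in>UNIV. 1 \<le> ennreal (exp (- k * r)) * ennreal (exp (k * (F x - m)))}"
    by simp
  also have "\<dots> \<le> ennreal (exp (- k * r)) * (\<integral>\<^sup>+ x. ennreal (exp (k * (F x - m))) * indicator UNIV x \<partial>gauss)"
    by (rule nn_integral_Markov_inequality) auto
  also have "\<dots> \<le> ennreal (exp (- k * r)) * ennreal (exp (pi\<^sup>2 * (k * l)\<^sup>2 / 8))"
    using mgf by (intro mult_left_mono) auto
  also have "\<dots> = ennreal (exp (- 2 * r\<^sup>2 / (pi\<^sup>2 * l\<^sup>2)))"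
  proof -
    have "- k * r + pi\<^sup>2 * (k * l)\<^sup>2 / 8 = - 2 * r\<^sup>2 / (pi\<^sup>2 * l\<^sup>2)"
      using l by (simp add: k_def field_simps power2_eq_square)
    then show ?thesis by (simp add: ennreal_mult[symmetric] exp_add[symmetric])
  qed
  finally show ?thesis
    by (simp add: gauss.emeasure_eq_measure m_def)
qed


section \<open>Concentration of the norm\<close>

text \<open>Allowing negative \<open>s\<close> makes the same estimate serve the lower tail, where
  small norms make the exponential large.\<close>

lemma gauss_norm_Chernoff:
  assumes s: "s < 1" and A: "A \<in> sets borel" and le: "\<And>x. x \<in> A \<Longrightarrow> b \<le> s * (norm x)\<^sup>2 / 2"
  shows "measure gauss A \<le> exp (- b) * (1 / sqrt (1 - s)) ^ d"
proof -
  have "emeasure gauss A = (\<integral>\<^sup>+ x. indicator A x \<partial>gauss)"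
    using A by simp
  also have "\<dots> \<le> (\<integral>\<^sup>+ x. ennreal (exp (- b)) * ennreal (exp (s * (norm x)\<^sup>2 / 2)) \<partial>gauss)"
  proof (rule nn_integral_mono)
    fix x
    show "indicator A x \<le> ennreal (exp (- b)) * ennreal (exp (s * (norm x)\<^sup>2 / 2))"
      using le[of x] by (auto simp: ennreal_mult[symmetric] exp_add[symmetric] split: split_indicator)
  qed
  also have "\<dots> = ennreal (exp (- b)) * ennreal ((1 / sqrt (1 - s)) ^ d)"
    by (subst nn_integral_cmult) (simp_all only: gauss_exp_norm_square[OF s], measurable)
  also have "\<dots> = ennreal (exp (- b) * (1 / sqrt (1 - s)) ^ d)"
    using s by (simp add: ennreal_mult)
  finally show ?thesis
    using s by (simp add: gauss.emeasure_eq_measure)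
qed

lemma gauss_norm_concentration:
  assumes t: "0 < t" "t \<le> 1"
  shows "measure gauss {x. \<bar>(norm x)\<^sup>2 / real d - 1\<bar> \<ge> t} \<le> 2 * exp (- real d * t\<^sup>2 / 16)"
proof -
  have dpos: "real d > 0" using dim_pos by simp
  \<comment> \<open>The second-order bound \<open>- ln (1 - s) \<le> s + 2 * s\<^sup>2\<close> holds
    for both signs of \<open>s\<close> up to modulus 1/2.\<close>
  have pow: "(1 / sqrt (1 - s)) ^ d \<le> exp (real d * (s + 2 * s\<^sup>2) / 2)" if "\<bar>s\<bar> \<le> 1/2" for s :: real
  proof -
    have "- ln (1 - s) \<le> s + 2 * s\<^sup>2"
    proof (cases "s \<ge> 0")
      case True
      then show ?thesis using ln_one_minus_pos_lower_bound[of s] that by simp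
    next
      case False
      then have "- s - s\<^sup>2 \<le> ln (1 - s)"
        using ln_one_plus_pos_lower_bound[of "- s"] that by simp
      moreover have "0 \<le> s\<^sup>2" by simp
      ultimately show ?thesis by linarith
    qed
    moreover have "1 / sqrt (1 - s) = exp (- ln (1 - s) / 2)"
      using that by (simp add: exp_minus ln_sqrt[symmetric] inverse_eq_divide)
    ultimately have "1 / sqrt (1 - s) \<le> exp ((s + 2 * s\<^sup>2) / 2)" by simp
    then have "(1 / sqrt (1 - s)) ^ d \<le> exp ((s + 2 * s\<^sup>2) / 2) ^ d"
      using that by (intro power_mono) auto
    then show ?thesis by (simp add: exp_of_nat_mult[symmetric])
  qed
  \<comment> \<open>For the upper tail the exponent is
    \<open>real d * (s\<^sup>2 - s * t / 2)\<close>, minimal at \<open>s = t / 4\<close>; for the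
    lower tail the sign of \<open>s\<close> is reversed. In both cases \<open>s * (1 + t)\<close> or
    \<open>s * (1 - t)\<close> equals \<open>s + t\<^sup>2 / 4\<close>, which allows a common
    treatment.\<close>
  have tail: "measure gauss A \<le> exp (- real d * t\<^sup>2 / 16)"
    if A: "A \<in> sets borel" and s: "s\<^sup>2 = (t / 4)\<^sup>2" and le: "\<And>x. x \<in> A \<Longrightarrow> real d * (s + t\<^sup>2 / 4) / 2 \<le> s * (norm x)\<^sup>2 / 2" for A s
  proof -
    have s_le: "\<bar>s\<bar> \<le> 1/2"
    proof -
      have "\<bar>s\<bar> = \<bar>t / 4\<bar>" using s by (simp only: power2_eq_iff abs_eq_iff)
      then show ?thesis using t by simp
    qed
    have "measure gauss A \<le> exp (- (real d * (s + t\<^sup>2 / 4) / 2)) * (1 / sqrt (1 - s)) ^ d"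
      using s_le by (intro gauss_norm_Chernoff[OF _ A le]) auto
    also have "\<dots> \<le> exp (- (real d * (s + t\<^sup>2 / 4) / 2)) * exp (real d * (s + 2 * s\<^sup>2) / 2)"
      by (intro mult_left_mono pow s_le) simp
    also have "\<dots> = exp (- real d * t\<^sup>2 / 16)"
    proof -
      have "- (real d * (s + t\<^sup>2 / 4) / 2) + real d * (s + 2 * s\<^sup>2) / 2 = - real d * t\<^sup>2 / 16"
        unfolding s by (simp add: field_simps power2_eq_square)
      then show ?thesis by (simp only: exp_add[symmetric])
    qed
    finally show ?thesis .
  qed
  have 1: "measure gauss {x. (norm x)\<^sup>2 \<ge> real d * (1 + t)} \<le> exp (- real d * t\<^sup>2 / 16)"
  proof (rule tail[of _ "t / 4"])
    fix x :: 'a assume "x \<in> {x. (norm x)\<^sup>2 \<ge> real d * (1 + t)}"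
    then have "t / 8 * (real d * (1 + t)) \<le> t / 8 * (norm x)\<^sup>2" using t by (intro mult_left_mono) auto
    then show "real d * (t / 4 + t\<^sup>2 / 4) / 2 \<le> t / 4 * (norm x)\<^sup>2 / 2"
      by (simp add: field_simps power2_eq_square)
  qed (auto intro: borel_measurable_le)
  have 2: "measure gauss {x. (norm x)\<^sup>2 \<le> real d * (1 - t)} \<le> exp (- real d * t\<^sup>2 / 16)"
  proof (rule tail[of _ "- t / 4"])
    fix x :: 'a assume "x \<in> {x. (norm x)\<^sup>2 \<le> real d * (1 - t)}"
    then have "t / 8 * (norm x)\<^sup>2 \<le> t / 8 * (real d * (1 - t))" using t by (intro mult_left_mono) auto
    then show "real d * (- t / 4 + t\<^sup>2 / 4) / 2 \<le> - t / 4 * (norm x)\<^sup>2 / 2"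
      by (simp add: field_simps power2_eq_square)
  qed auto
  have "{x::'a. \<bar>(norm x)\<^sup>2 / real d - 1\<bar> \<ge> t}
      = {x. (norm x)\<^sup>2 \<ge> real d * (1 + t)} \<union> {x. (norm x)\<^sup>2 \<le> real d * (1 - t)}"
  proof -
    have "\<bar>z / real d - 1\<bar> \<ge> t \<longleftrightarrow> z \<ge> real d * (1 + t) \<or> z \<le> real d * (1 - t)" for z
    proof -
      have "\<bar>z / real d - 1\<bar> \<ge> t \<longleftrightarrow> 1 + t \<le> z / real d \<or> z / real d \<le> 1 - t"
        using t by linarith
      then show ?thesis using dpos by (simp add: pos_le_divide_eq pos_divide_le_eq mult.commute)
    qed
    then show ?thesis by blast
  qed
  then have "measure gauss {x. \<bar>(norm x)\<^sup>2 / real d - 1\<bar> \<ge> t}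
      \<le> measure gauss {x. (norm x)\<^sup>2 \<ge> real d * (1 + t)} + measure gauss {x. (norm x)\<^sup>2 \<le> real d * (1 - t)}"
    by (simp only:) (rule measure_Un_le, simp_all)
  then show ?thesis using 1 2 by simp
qed

end

section \<open>Approximation of Lipschitz functions by smoothed steps\<close>

text \<open>The integral of a tent of height 2 on \<open>[0, 1]\<close>: the continuous derivative
  is required by the concentration argument, and the height 2 is the price for rising by 1 over a
  unit interval.\<close>

definition step :: "real \<Rightarrow> real" where
  "step t = 2 * ((max 0 t)\<^sup>2 - 2 * (max 0 (t - 1/2))\<^sup>2 + (max 0 (t - 1))\<^sup>2)"

definition step' :: "real \<Rightarrow> real" where
  "step' t = 4 * (max 0 t - 2 * max 0 (t - 1/2) + max 0 (t - 1))"

lemma step_eq_0: "t \<le> 0 \<Longrightarrow> step t = 0"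
  by (simp add: step_def)

lemma step_eq_1: "t \<ge> 1 \<Longrightarrow> step t = 1"
  by (simp add: step_def power2_eq_square algebra_simps)

lemma step'_eq_0: "t \<le> 0 \<or> t \<ge> 1 \<Longrightarrow> step' t = 0"
  by (auto simp: step'_def)

lemma step'_bounds: "0 \<le> step' t" "step' t \<le> 2"
  by (auto simp: step'_def max_def)

lemma DERIV_max_0_square: "((\<lambda>t::real. (max 0 t)\<^sup>2) has_real_derivative 2 * max 0 t) (at t)"
proof -
  consider "t < 0" | "t > 0" | "t = 0" by linarith
  then show ?thesis
  proof cases
    case 1
    then have "((\<lambda>t::real. (max 0 t)\<^sup>2) has_real_derivative 2 * max 0 t) (at t) \<longleftrightarrow> ((\<lambda>_. 0) has_real_derivative 0) (at t)"
      by (intro DERIV_cong_ev) (auto intro: eventually_mono[OF eventually_nhds_in_open[of "{..<0}"]])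
    then show ?thesis by simp
  next
    case 2
    then have "((\<lambda>t::real. (max 0 t)\<^sup>2) has_real_derivative 2 * max 0 t) (at t) \<longleftrightarrow> ((\<lambda>t. t\<^sup>2) has_real_derivative 2 * t) (at t)"
      by (intro DERIV_cong_ev) (auto intro: eventually_mono[OF eventually_nhds_in_open[of "{0<..}"]])
    then show ?thesis by (auto intro!: derivative_eq_intros)
  next
    case 3
    have "((\<lambda>h::real. (max 0 h)\<^sup>2 / h) \<longlongrightarrow> 0) (at 0)"
    proof (rule Lim_null_comparison)
      show "\<forall>\<^sub>F h::real in at 0. norm ((max 0 h)\<^sup>2 / h) \<le> \<bar>h\<bar>"
        by (intro always_eventually) (auto simp: max_def power2_eq_square)
      show "((\<lambda>h::real. \<bar>h\<bar>) \<longlongrightarrow> 0) (at 0)" by (auto intro!: tendsto_eq_intros)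
    qed
    then show ?thesis by (simp add: 3 DERIV_def)
  qed
qed

lemma DERIV_step [derivative_intros]:
  "(g has_real_derivative D) (at x) \<Longrightarrow> ((\<lambda>x. step (g x)) has_real_derivative step' (g x) * D) (at x)"
proof -
  have "(step has_real_derivative step' t) (at t)" for t
    unfolding step_def[abs_def] step'_def
    by (rule derivative_eq_intros DERIV_max_0_square DERIV_chain2[OF DERIV_max_0_square] refl | simp)+
  then show "(g has_real_derivative D) (at x) \<Longrightarrow> ((\<lambda>x. step (g x)) has_real_derivative step' (g x) * D) (at x)"
    by (rule DERIV_chain2)
qed

lemma continuous_on_step': "continuous_on S step'"
  unfolding step'_def[abs_def] by (intro continuous_intros)

lemma step_bounds: "0 \<le> step t" "step t \<le> 1"
proof -
  have mono: "step a \<le> step b" if "a \<le> b" for a b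
    using that
  proof (rule DERIV_nonneg_imp_nondecreasing)
    fix x show "\<exists>y. (step has_real_derivative y) (at x) \<and> 0 \<le> y"
      using DERIV_step[OF DERIV_ident, of x] step'_bounds by (intro exI[of _ "step' x"]) simp
  qed
  show "0 \<le> step t" using mono[of "min 0 t" t] by (simp add: step_eq_0)
  show "step t \<le> 1" using mono[of t "max 1 t"] by (simp add: step_eq_1)
qed

text \<open>The supports of the translates of \<open>step'\<close> by integers are disjoint.\<close>

lemma sum_step'_le:
  assumes "\<And>k. \<bar>w k\<bar> \<le> 1"
  shows "\<bar>\<Sum>k<K. w k * step' (y - real k)\<bar> \<le> 2"
proof -
  have zero: "step' (y - real k) = 0" if "k \<noteq> nat \<lfloor>y\<rfloor>" for k
  proof (rule step'_eq_0, rule ccontr)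
    assume "\<not> (y - real k \<le> 0 \<or> 1 \<le> y - real k)"
    then have "\<lfloor>y\<rfloor> = int k" by (intro floor_unique) auto
    then show False using that by simp
  qed
  have "(\<Sum>k<K. w k * step' (y - real k)) = (\<Sum>k<K. if k = nat \<lfloor>y\<rfloor> then w k * step' (y - real k) else 0)"
    by (intro sum.cong) (auto simp: zero)
  also have "\<bar>\<dots>\<bar> \<le> 2"
    using assms[of "nat \<lfloor>y\<rfloor>"] step'_bounds[of "y - real (nat \<lfloor>y\<rfloor>)"]
      mult_mono[of "\<bar>w (nat \<lfloor>y\<rfloor>)\<bar>" 1 "step' (y - real (nat \<lfloor>y\<rfloor>))" 2]
    by (simp add: sum.delta abs_mult)
  finally show ?thesis .
qed

text \<open>The weights are the difference quotients of \<open>f\<close> on the grid of mesh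
  \<open>h\<close> in \<open>[- R, R]\<close>. On a cell the approximant is a convex combination of
  the two grid values, each within \<open>h\<close> of \<open>f x\<close>.\<close>

lemma Lipschitz_step_approximation:
  fixes f :: "real \<Rightarrow> real"
  assumes lip: "\<And>x y. \<bar>f x - f y\<bar> \<le> \<bar>x - y\<bar>" and bd: "\<And>x. \<bar>f x\<bar> \<le> 1"
    and h: "h > 0" and R: "R > 0" and K: "real K * h = 2 * R"
  shows "\<exists>a w. (\<forall>k. \<bar>w k\<bar> \<le> 1) \<and>
    (\<forall>x. \<bar>f x - (a + (\<Sum>k<K. h * w k * step ((x + R) / h - real k)))\<bar> \<le> h + 2 * x\<^sup>2 / R\<^sup>2)"
proof -
  define p where "p k = - R + h * real k" for k :: nat
  define w where "w k = (f (p (Suc k)) - f (p k)) / h" for k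
  define G where "G x = f (- R) + (\<Sum>k<K. h * w k * step ((x + R) / h - real k))" for x
  have "\<bar>w k\<bar> \<le> 1" for k
    using lip[of "p (Suc k)" "p k"] h by (simp add: w_def p_def field_simps)
  moreover have "\<bar>f x - G x\<bar> \<le> h + 2 * x\<^sup>2 / R\<^sup>2" for x
  proof -
    define y where "y = (x + R) / h"
    have hw: "h * w k = f (p (Suc k)) - f (p k)" for k using h by (simp add: w_def)
    have x: "x = - R + h * y" using h by (simp add: y_def)
    have tele: "(\<Sum>k<j. h * w k) = f (p j) - f (- R)" for j
      using sum_lessThan_telescope[of "\<lambda>k. f (p k)" j] by (simp only: hw) (simp add: p_def)
    have pK: "p K = R" using K by (simp add: p_def mult.commute)
    \<comment> \<open>Beyond the grid the approximant is constant, and the trivial error 2 is at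
      most \<open>2 * x\<^sup>2 / R\<^sup>2\<close>.\<close>
    have outside: "\<bar>f x - G x\<bar> \<le> h + 2 * x\<^sup>2 / R\<^sup>2" if "\<bar>x\<bar> \<ge> R" "\<bar>G x\<bar> \<le> 1"
    proof -
      have "R\<^sup>2 \<le> x\<^sup>2" using that(1) R by (simp add: abs_le_square_iff[symmetric])
      then have "2 \<le> 2 * x\<^sup>2 / R\<^sup>2" using R by (simp add: field_simps)
      then show ?thesis using bd[of x] that(2) h by linarith
    qed
    consider "y \<le> 0" | "y \<ge> real K" | "0 < y" "y < real K" by linarith
    then show ?thesis
    proof cases
      case 1
      then have "G x = f (- R)"
        unfolding G_def y_def[symmetric] by (simp add: step_eq_0)
      moreover have "x \<le> - R" using 1 h by (simp add: x mult_nonneg_nonpos)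
      ultimately show ?thesis using bd[of "- R"] by (intro outside) auto
    next
      case 2
      have "step (y - real k) = 1" if "k < K" for k
        using 2 that by (intro step_eq_1) linarith
      then have "G x = f (- R) + (\<Sum>k<K. h * w k)"
        unfolding G_def y_def[symmetric] by simp
      then have "G x = f R" by (simp add: tele pK)
      moreover have "x \<ge> R" using 2 h K mult_left_mono[of "real K" y h] by (simp add: x mult.commute)
      ultimately show ?thesis using bd[of R] by (intro outside) auto
    next
      case 3
      define j where "j = nat \<lfloor>y\<rfloor>"
      have j: "real j \<le> y" "y < real j + 1" using 3(1) by (auto simp: j_def)
      then have jK: "j < K" using 3(2) by linarith
      define s where "s = step (y - real j)"
      have s: "0 \<le> s" "s \<le> 1" by (auto simp: s_def step_bounds)
      \<comment> \<open>For \<open>y\<close> in cell \<open>j\<close> the steps before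
        \<open>j\<close> are complete, those after \<open>j\<close> have not begun, and step
        \<open>j\<close> alone is fractional.\<close>
      have "(\<Sum>k<K. h * w k * step (y - real k)) = (\<Sum>k<Suc j. h * w k * step (y - real k))"
      proof (rule sum.mono_neutral_right)
        show "\<forall>i\<in>{..<K} - {..<Suc j}. h * w i * step (y - real i) = 0"
          using j by (auto simp: step_eq_0)
      qed (use jK in auto)
      also have "\<dots> = (\<Sum>k<j. h * w k) + h * w j * s"
        using j by (simp add: s_def step_eq_1)
      finally have G: "G x = (1 - s) * f (p j) + s * f (p (Suc j))"
        unfolding G_def y_def[symmetric] tele by (simp add: hw algebra_simps)
      have "\<bar>f x - f (p j)\<bar> \<le> h"
      proof -
        have "\<bar>x - p j\<bar> = h * (y - real j)"
          using j h by (simp add: x p_def abs_mult flip: right_diff_distrib)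
        also have "\<dots> \<le> h" using j h by simp
        finally show ?thesis using lip order_trans by blast
      qed
      moreover have "\<bar>f x - f (p (Suc j))\<bar> \<le> h"
      proof -
        have "\<bar>x - p (Suc j)\<bar> = h * \<bar>y - real (Suc j)\<bar>"
          using h by (simp add: x p_def abs_mult flip: right_diff_distrib)
        also have "\<dots> \<le> h" using j h by simp
        finally show ?thesis using lip order_trans by blast
      qed
      ultimately have "(1 - s) * \<bar>f x - f (p j)\<bar> + s * \<bar>f x - f (p (Suc j))\<bar> \<le> (1 - s) * h + s * h"
        using s by (intro add_mono mult_left_mono) auto
      moreover have "\<bar>f x - G x\<bar> \<le> (1 - s) * \<bar>f x - f (p j)\<bar> + s * \<bar>f x - f (p (Suc j))\<bar>"
      proof -
        have "f x - G x = (1 - s) * (f x - f (p j)) + s * (f x - f (p (Suc j)))"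
          by (simp add: G algebra_simps)
        then show ?thesis
          using abs_triangle_ineq[of "(1 - s) * (f x - f (p j))" "s * (f x - f (p (Suc j)))"] s
          by (simp add: abs_mult)
      qed
      moreover have "(1 - s) * h + s * h = h" by (simp add: algebra_simps)
      moreover have "0 \<le> 2 * x\<^sup>2 / R\<^sup>2" by simp
      ultimately show ?thesis by linarith
    qed
  qed
  ultimately show ?thesis unfolding G_def by blast
qed

section \<open>Test functions and their averages\<close>

text \<open>The sup norm is an essential supremum, so the bound holds at first almost everywhere.
  Continuity makes the exceptional set open, and an open null set is empty.\<close>

lemma
  assumes "bl_norm f \<le> 1"
  shows bl_norm_le_1_Lipschitz: "\<bar>f x - f y\<bar> \<le> \<bar>x - y\<bar>"
    and bl_norm_le_1_bounded: "\<bar>f x\<bar> \<le> 1"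
proof -
  have lip: "\<bar>f x - f y\<bar> \<le> \<bar>x - y\<bar>" for x y
  proof (cases "x = y")
    case False
    have "ereal (\<bar>f x - f y\<bar> / \<bar>x - y\<bar>) \<le> (SUP (x, y)\<in>{(x, y). x \<noteq> y}. ereal (\<bar>f x - f y\<bar> / \<bar>x - y\<bar>))"
      using False by (intro SUP_upper2[of "(x, y)"]) auto
    also have "\<dots> \<le> 1" using assms by (simp add: bl_norm_def)
    finally show ?thesis using False by (simp add: divide_le_eq split: if_splits)
  qed simp
  then show "\<bar>f x - f y\<bar> \<le> \<bar>x - y\<bar>" .
  have cont: "continuous_on UNIV f"
    by (intro lipschitz_on_continuous_on[of 1] lipschitz_onI) (auto simp: dist_real_def lip)
  have "esssup lborel (\<lambda>x. ereal \<bar>f x\<bar>) \<le> 1"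
    using assms by (simp add: bl_norm_def)
  then have "AE x in lborel. ereal \<bar>f x\<bar> \<le> 1"
    using esssup_AE[of "\<lambda>x. ereal \<bar>f x\<bar>" lborel] by (auto elim!: eventually_mono dest: order_trans)
  then have ae: "AE x in lborel. \<bar>f x\<bar> \<le> 1" by simp
  have "closed {x. \<bar>f x\<bar> \<le> 1}"
    by (intro closed_Collect_le continuous_intros cont)
  then have op: "open {x. \<not> \<bar>f x\<bar> \<le> 1}"
    by (simp add: closed_def Collect_neg_eq)
  have "{x. \<not> \<bar>f x\<bar> \<le> 1} \<in> null_sets lborel"
    using ae by (subst (asm) AE_iff_null) (use op in simp_all)
  then have "negligible {x. \<not> \<bar>f x\<bar> \<le> 1}"
    unfolding negligible_iff_null_sets by (rule null_sets_completionI)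
  then have "{x. \<not> \<bar>f x\<bar> \<le> 1} = {}"
    using open_not_negligible[OF op] by blast
  then show "\<bar>f x\<bar> \<le> 1" by blast
qed

definition staircase :: "real \<Rightarrow> real \<Rightarrow> nat \<Rightarrow> (nat \<Rightarrow> real) \<Rightarrow> real \<Rightarrow> real" where
  "staircase h R K w z = (\<Sum>k<K. h * w k * step ((z + R) / h - real k))"

text \<open>The step height \<open>h\<close> cancels the \<open>1 / h\<close> of the chain rule, so
  the slope bound does not depend on the mesh.\<close>

definition staircase' :: "real \<Rightarrow> real \<Rightarrow> nat \<Rightarrow> (nat \<Rightarrow> real) \<Rightarrow> real \<Rightarrow> real" where
  "staircase' h R K w z = (\<Sum>k<K. w k * step' ((z + R) / h - real k))"

lemma DERIV_staircase:
  assumes "h > 0"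
  shows "(staircase h R K w has_real_derivative staircase' h R K w z) (at z)"
  unfolding staircase_def[abs_def] staircase'_def
  using assms by (auto intro!: derivative_eq_intros sum.cong)

lemma continuous_on_staircase': "h > 0 \<Longrightarrow> continuous_on S (staircase' h R K w)"
  unfolding staircase'_def[abs_def]
  by (intro continuous_intros continuous_on_compose2[OF continuous_on_step'[of UNIV]]) auto

lemma abs_staircase'_le: "(\<And>k. \<bar>w k\<bar> \<le> 1) \<Longrightarrow> \<bar>staircase' h R K w z\<bar> \<le> 2"
  unfolding staircase'_def by (rule sum_step'_le)

lemma step_measurable [measurable]: "step \<in> borel_measurable borel"
  unfolding step_def[abs_def] by measurable

lemma staircase_measurable [measurable]: "staircase h R K w \<in> borel_measurable borel"
  unfolding staircase_def[abs_def] by measurable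

lemma abs_staircase_le:
  assumes "\<And>k. \<bar>w k\<bar> \<le> 1" "h > 0"
  shows "\<bar>staircase h R K w z\<bar> \<le> real K * h"
proof -
  have "\<bar>staircase h R K w z\<bar> \<le> (\<Sum>k<K. h)"
    unfolding staircase_def
  proof (rule order_trans[OF sum_abs], rule sum_mono)
    fix k
    have "\<bar>h * w k\<bar> * \<bar>step ((z + R) / h - real k)\<bar> \<le> h * 1"
      using assms step_bounds[of "(z + R) / h - real k"] by (intro mult_mono) (auto simp: abs_mult)
    then show "\<bar>h * w k * step ((z + R) / h - real k)\<bar> \<le> h" by (simp add: abs_mult)
  qed
  then show ?thesis by simp
qed

lemma prob_space_std_normal: "prob_space std_normal_distribution"
  by (rule prob_space_normal_density) simp

lemma
  shows integrable_std_normal_square: "integrable std_normal_distribution (\<lambda>x. x\<^sup>2)"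
    and integral_std_normal_square: "(\<integral>x. x\<^sup>2 \<partial>std_normal_distribution) = 1"
  using integrable_std_normal_moment[of 2] integral_std_normal_moment_even[of 1]
  by (auto simp: integrable_density integral_density)

lemma integral_empirical_measure:
  fixes u :: "real^'v::finite"
  assumes "f \<in> borel_measurable borel"
  shows "(\<integral>x. f x \<partial>empirical_measure u) = (\<Sum>i\<in>UNIV. f (sqrt (real CARD('v)) * u $ i)) / real CARD('v)"
  unfolding empirical_measure_def
  using assms by (subst integral_distr) (auto simp: integral_uniform_count_measure)

lemma sum_abs_le_norm:
  fixes x :: "real^'v::finite"
  shows "(\<Sum>i\<in>UNIV. \<bar>x $ i\<bar>) \<le> sqrt (real CARD('v)) * norm x"
proof (rule power2_le_imp_le)
  have "(\<Sum>i\<in>UNIV. \<bar>x $ i\<bar>)\<^sup>2 \<le> (\<Sum>i\<in>UNIV. \<bar>x $ i\<bar>\<^sup>2) * real CARD('v)"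
    by (rule sum_squared_le_sum_of_squares)
  also have "\<dots> = (sqrt (real CARD('v)) * norm x)\<^sup>2"
    by (simp add: norm_vec_def L2_set_def power_mult_distrib sum_nonneg mult.commute)
  finally show "(\<Sum>i\<in>UNIV. \<bar>x $ i\<bar>)\<^sup>2 \<le> (sqrt (real CARD('v)) * norm x)\<^sup>2" .
qed simp

text \<open>The deterministic part of the argument. The term \<open>t\<close> pays for renormalising
  \<open>x\<close>, \<open>\<tau>\<close> for the deviation of the staircases, and the rest for
  replacing \<open>f\<close> by a staircase under both measures.\<close>

lemma bl_dist_empirical_measure_sgn_le:
  fixes x :: "real^'v::finite"
  defines "n \<equiv> real CARD('v)"
  assumes m: "m > 0" and x: "x \<noteq> 0" and t: "\<bar>(norm x)\<^sup>2 / m - 1\<bar> \<le> t"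
    and h: "h > 0" and R: "R > 0" and K: "real K * h = 2 * R"
    and dev: "\<And>A. let w = (\<lambda>k. if k \<in> A then 1 else - 1) in
      (\<Sum>i\<in>UNIV. staircase h R K w (sqrt (n / m) * x $ i)) / n
        - (\<integral>z. staircase h R K w z \<partial>std_normal_distribution) \<le> \<tau>"
  shows "bl_dist (empirical_measure (sgn x)) std_normal_distribution \<le> t + 2 * h + 2 * (2 + t) / R\<^sup>2 + \<tau>"
proof -
  interpret N: prob_space std_normal_distribution by (rule prob_space_std_normal)
  define \<kappa> where "\<kappa> = sqrt (n / m)"
  have n: "n > 0" by (simp add: n_def)
  define avg where "avg \<phi> = (\<Sum>i\<in>UNIV. \<phi> (\<kappa> * x $ i)) / n" for \<phi> :: "real \<Rightarrow> real"
  define E where "E \<phi> = (\<integral>z. \<phi> z \<partial>std_normal_distribution)" for \<phi> :: "real \<Rightarrow> real"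
  have avg_square: "avg (\<lambda>z. z\<^sup>2) = (norm x)\<^sup>2 / m"
  proof -
    have "(\<Sum>i\<in>UNIV. (\<kappa> * x $ i)\<^sup>2) = (n / m) * (norm x)\<^sup>2"
      using n m by (simp add: \<kappa>_def norm_vec_def L2_set_def power_mult_distrib sum_nonneg sum_distrib_left)
    then show ?thesis using n by (simp add: avg_def)
  qed
  have main: "\<bar>E f - (\<integral>z. f z \<partial>empirical_measure (sgn x))\<bar> \<le> t + 2 * h + 2 * (2 + t) / R\<^sup>2 + \<tau>"
    if f: "bl_norm f \<le> 1" for f
  proof -
    note lip = bl_norm_le_1_Lipschitz[OF f] and bd = bl_norm_le_1_bounded[OF f]
    have "continuous_on UNIV f"
      by (intro lipschitz_on_continuous_on[of 1] lipschitz_onI) (auto simp: dist_real_def lip)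
    then have f_meas [measurable]: "f \<in> borel_measurable borel"
      by (rule borel_measurable_continuous_onI)
    have f_int: "integrable std_normal_distribution f"
      using bd by (intro N.integrable_const_bound[of _ 1]) auto
    have 1: "\<bar>(\<integral>z. f z \<partial>empirical_measure (sgn x)) - avg f\<bar> \<le> t"
    proof -
      have "\<bar>(\<Sum>i\<in>UNIV. f (sqrt n * sgn x $ i)) - (\<Sum>i\<in>UNIV. f (\<kappa> * x $ i))\<bar>
          \<le> (\<Sum>i\<in>UNIV. \<bar>f (sqrt n * sgn x $ i) - f (\<kappa> * x $ i)\<bar>)"
        unfolding sum_subtractf[symmetric] by (rule sum_abs)
      also have "\<dots> \<le> (\<Sum>i\<in>UNIV. sqrt n * \<bar>1 / norm x - 1 / sqrt m\<bar> * \<bar>x $ i\<bar>)"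
      proof (rule sum_mono)
        fix i
        have "sqrt n * sgn x $ i - \<kappa> * x $ i = sqrt n * (1 / norm x - 1 / sqrt m) * x $ i"
        proof -
          have "\<kappa> = sqrt n * inverse (sqrt m)" by (simp add: \<kappa>_def divide_inverse real_sqrt_mult real_sqrt_inverse)
          then show ?thesis by (simp add: sgn_div_norm divide_inverse algebra_simps)
        qed
        then show "\<bar>f (sqrt n * sgn x $ i) - f (\<kappa> * x $ i)\<bar> \<le> sqrt n * \<bar>1 / norm x - 1 / sqrt m\<bar> * \<bar>x $ i\<bar>"
          using lip[of "sqrt n * sgn x $ i" "\<kappa> * x $ i"] n by (simp add: abs_mult)
      qed
      also have "\<dots> = sqrt n * \<bar>1 / norm x - 1 / sqrt m\<bar> * (\<Sum>i\<in>UNIV. \<bar>x $ i\<bar>)"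
        by (simp add: sum_distrib_left)
      also have "\<dots> \<le> sqrt n * \<bar>1 / norm x - 1 / sqrt m\<bar> * (sqrt n * norm x)"
        unfolding n_def by (intro mult_left_mono sum_abs_le_norm) auto
      also have "\<dots> = n * (\<bar>1 / norm x - 1 / sqrt m\<bar> * norm x)"
        using n by simp
      also have "\<bar>1 / norm x - 1 / sqrt m\<bar> * norm x = \<bar>1 - norm x / sqrt m\<bar>"
      proof -
        have "(1 / norm x - 1 / sqrt m) * norm x = 1 - norm x / sqrt m"
          using x by (simp add: left_diff_distrib)
        then show ?thesis by (metis abs_mult abs_norm_cancel)
      qed
      \<comment> \<open>For \<open>z \<ge> 0\<close> the factorisation of
        \<open>z\<^sup>2 - 1\<close> gives
        \<open>\<bar>1 - z\<bar> \<le> \<bar>z\<^sup>2 - 1\<bar>\<close>, so control of the squared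
        norm is enough.\<close>
      also have "\<bar>1 - norm x / sqrt m\<bar> \<le> t"
      proof -
        define z where "z = norm x / sqrt m"
        have z: "z \<ge> 0" using m by (simp add: z_def)
        have "z\<^sup>2 - 1 = - ((1 - z) * (1 + z))" by (simp add: power2_eq_square algebra_simps)
        then have "\<bar>z\<^sup>2 - 1\<bar> = \<bar>1 - z\<bar> * (1 + z)"
          using z by (simp add: abs_mult)
        moreover have "\<bar>1 - z\<bar> * 1 \<le> \<bar>1 - z\<bar> * (1 + z)" using z by (intro mult_left_mono) auto
        moreover have "z\<^sup>2 = (norm x)\<^sup>2 / m" using m by (simp add: z_def power_divide)
        ultimately show ?thesis using t by (simp add: z_def)
      qed
      finally have "\<bar>(\<Sum>i\<in>UNIV. f (sqrt n * sgn x $ i)) - (\<Sum>i\<in>UNIV. f (\<kappa> * x $ i))\<bar> \<le> n * t"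
        using n by (simp add: mult_left_mono)
      then show ?thesis
        using n by (simp add: integral_empirical_measure avg_def n_def[symmetric] abs_le_iff field_simps)
    qed
    obtain a w where w: "\<And>k. \<bar>w k\<bar> \<le> 1"
      and approx: "\<And>z. \<bar>f z - (a + staircase h R K w z)\<bar> \<le> h + 2 * z\<^sup>2 / R\<^sup>2"
      using Lipschitz_step_approximation[OF lip bd h R K] unfolding staircase_def by blast
    \<comment> \<open>The quadratic error is averaged against the second moment, which is
      \<open>(norm x)\<^sup>2 / m \<le> 1 + t\<close> here and 1 for the Gaussian below. The
      constant \<open>a\<close> later cancels, since both averages have total mass 1.\<close>
    have 2: "\<bar>avg f - (a + avg (staircase h R K w))\<bar> \<le> h + 2 * (1 + t) / R\<^sup>2"
    proof -
      have "avg f - (a + avg (staircase h R K w)) = avg (\<lambda>z. f z - (a + staircase h R K w z))"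
        using n by (simp add: avg_def sum_subtractf sum.distrib n_def field_simps)
      also have "\<bar>\<dots>\<bar> \<le> avg (\<lambda>z. \<bar>f z - (a + staircase h R K w z)\<bar>)"
        using n by (simp add: avg_def divide_right_mono)
      also have "\<dots> \<le> avg (\<lambda>z. h + 2 / R\<^sup>2 * z\<^sup>2)"
        unfolding avg_def using n approx by (intro divide_right_mono sum_mono) auto
      also have "\<dots> = h + 2 / R\<^sup>2 * avg (\<lambda>z. z\<^sup>2)"
        using n by (simp add: avg_def sum.distrib n_def sum_distrib_left add_divide_distrib)
      also have "\<dots> \<le> h + 2 / R\<^sup>2 * (1 + t)"
        using t by (intro add_left_mono mult_left_mono) (auto simp: avg_square abs_le_iff)
      finally show ?thesis by simp
    qed
    have st_int: "integrable std_normal_distribution (staircase h R K w)"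
      using abs_staircase_le[OF w h] by (intro N.integrable_const_bound[of _ "real K * h"]) auto
    have 3: "\<bar>E f - (a + E (staircase h R K w))\<bar> \<le> h + 2 / R\<^sup>2"
    proof -
      have "E f - (a + E (staircase h R K w)) = E (\<lambda>z. f z - (a + staircase h R K w z))"
        using f_int st_int N.prob_space by (simp add: E_def)
      also have "\<bar>\<dots>\<bar> \<le> E (\<lambda>z. h + 2 / R\<^sup>2 * z\<^sup>2)"
        unfolding E_def
      proof (rule order_trans[OF integral_abs_bound integral_mono])
        show "integrable std_normal_distribution (\<lambda>z. \<bar>f z - (a + staircase h R K w z)\<bar>)"
          using f_int st_int by auto
        show "integrable std_normal_distribution (\<lambda>z. h + 2 / R\<^sup>2 * z\<^sup>2)"
          using integrable_std_normal_square by auto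
      qed (use approx in auto)
      also have "\<dots> = h + 2 / R\<^sup>2"
        using integrable_std_normal_square integral_std_normal_square N.prob_space by (simp add: E_def)
      finally show ?thesis .
    qed
    have 4: "\<bar>avg (staircase h R K w) - E (staircase h R K w)\<bar> \<le> \<tau>"
    proof -
      define s where "s k z = step ((z + R) / h - real k)" for k z
      define D where "D k = avg (s k) - E (s k)" for k
      have [measurable]: "s k \<in> borel_measurable borel" for k
        unfolding s_def[abs_def] by measurable
      have s_int: "integrable std_normal_distribution (s k)" for k
        using step_bounds by (intro N.integrable_const_bound[of _ 1]) (simp_all, simp add: s_def)
      have st: "avg (staircase h R K v) - E (staircase h R K v) = (\<Sum>k<K. h * v k * D k)" for v
      proof -
        have "avg (staircase h R K v) = (\<Sum>k<K. h * v k * avg (s k))"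
          unfolding avg_def staircase_def s_def[symmetric]
          by (subst sum.swap) (simp add: sum_distrib_left sum_divide_distrib)
        moreover have "E (staircase h R K v) = (\<Sum>k<K. h * v k * E (s k))"
          unfolding E_def staircase_def s_def[symmetric] using s_int by simp
        ultimately show ?thesis by (simp add: D_def sum_subtractf right_diff_distrib)
      qed
      \<comment> \<open>The deviation is linear in the weights, so adapting their signs to those of
        \<open>D k\<close> dominates all other choices. The absolute value is covered as well, which
        is why \<open>dev\<close> needs only one side.\<close>
      have "\<bar>\<Sum>k<K. h * w k * D k\<bar> \<le> (\<Sum>k<K. h * \<bar>D k\<bar>)"
      proof (rule order_trans[OF sum_abs], rule sum_mono)
        fix k
        have "\<bar>w k\<bar> * \<bar>D k\<bar> \<le> 1 * \<bar>D k\<bar>" using w by (intro mult_right_mono) auto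
        then show "\<bar>h * w k * D k\<bar> \<le> h * \<bar>D k\<bar>" using h by (simp add: abs_mult mult.assoc)
      qed
      also have "\<dots> = (\<Sum>k<K. h * (if k \<in> {k. D k \<ge> 0} then 1 else - 1) * D k)"
        by (intro sum.cong) auto
      also have "\<dots> \<le> \<tau>"
        using dev[of "{k. D k \<ge> 0}"] unfolding st[symmetric] by (simp add: avg_def E_def \<kappa>_def Let_def)
      finally show ?thesis by (simp add: st)
    qed
    have "2 * (1 + t) / R\<^sup>2 + 2 / R\<^sup>2 = 2 * (2 + t) / R\<^sup>2" by (simp add: add_divide_distrib[symmetric])
    with 1 2 3 4 show ?thesis by linarith
  qed
  \<comment> \<open>The supremum of reals is conditionally complete, so the index set must be seen
    to be nonempty.\<close>
  have "bl_norm (\<lambda>_. 0) \<le> 1"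
    by (auto simp: bl_norm_def esssup_const intro!: SUP_least)
  then have "{f. bl_norm f \<le> 1} \<noteq> {}" by blast
  then show ?thesis
    unfolding bl_dist_def using main by (intro cSUP_least) (auto simp: E_def)
qed

section \<open>Eigenspaces of vertex-transitive graphs\<close>

lemma automorphism_adjacency:
  fixes G :: "('v::finite, 'e) pre_digraph"
  assumes "graph G" and h: "graph_automorphism G h" and V: "verts G = UNIV"
  shows "bij (iso_verts h)"
    and "adjacency_matrix G $ iso_verts h i $ iso_verts h j = adjacency_matrix G $ i $ j"
proof -
  interpret graph G by fact
  have iso: "digraph_isomorphism h" and app: "app_iso h G = G"
    using h by (auto simp: graph_automorphism_def)
  have inj: "inj (iso_verts h)"
    using digraph_isomorphism_inj_on_verts[OF iso] V by simp
  then show "bij (iso_verts h)" by (simp add: bij_def finite_UNIV_inj_surj)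
  have "arcs_ends G = (\<lambda>(u, v). (iso_verts h u, iso_verts h v)) ` arcs_ends G"
    by (rule arcs_ends_app_iso_eq[OF iso, unfolded app])
  then have "iso_verts h i \<rightarrow>\<^bsub>G\<^esub> iso_verts h j
      \<longleftrightarrow> (iso_verts h i, iso_verts h j) \<in> (\<lambda>(u, v). (iso_verts h u, iso_verts h v)) ` arcs_ends G"
    by (rule arg_cong)
  also have "\<dots> \<longleftrightarrow> i \<rightarrow>\<^bsub>G\<^esub> j"
    using inj by (force simp: inj_eq)
  finally have "iso_verts h i \<rightarrow>\<^bsub>G\<^esub> iso_verts h j \<longleftrightarrow> i \<rightarrow>\<^bsub>G\<^esub> j" .
  then show "adjacency_matrix G $ iso_verts h i $ iso_verts h j = adjacency_matrix G $ i $ j"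
    by (simp add: adjacency_matrix_def)
qed

lemma subspace_eigenspace:
  assumes "is_eigenspace A E" shows "subspace E"
  using assms by (auto simp: is_eigenspace_def subspace_def matrix_vector_right_distrib scaleR_right_distrib
      matrix_vector_mult_scaleR mult.commute)

text \<open>The permutation matrix of an automorphism commutes with the adjacency matrix.\<close>

lemma eigenspace_permute:
  fixes G :: "('v::finite, 'e) pre_digraph"
  assumes "graph G" "graph_automorphism G h" "verts G = UNIV"
    and E: "is_eigenspace (adjacency_matrix G) E" and x: "x \<in> E"
  shows "(\<chi> i. x $ iso_verts h i) \<in> E"
proof -
  note aut = automorphism_adjacency[OF assms(1-3)]
  obtain l where l: "E = {x. adjacency_matrix G *v x = l *\<^sub>R x}"
    using E by (auto simp: is_eigenspace_def)
  have "(\<Sum>j\<in>UNIV. adjacency_matrix G $ i $ j * x $ iso_verts h j) = l * x $ iso_verts h i" for i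
  proof -
    have "(\<Sum>j\<in>UNIV. adjacency_matrix G $ i $ j * x $ iso_verts h j)
        = (\<Sum>j\<in>UNIV. adjacency_matrix G $ iso_verts h i $ iso_verts h j * x $ iso_verts h j)"
      by (simp add: aut(2))
    also have "\<dots> = (\<Sum>k\<in>UNIV. adjacency_matrix G $ iso_verts h i $ k * x $ k)"
      using aut(1) by (rule sum.reindex_bij_betw)
    also have "\<dots> = (adjacency_matrix G *v x) $ iso_verts h i"
      by (simp add: matrix_vector_mult_def)
    also have "\<dots> = l * x $ iso_verts h i"
      using x by (simp add: l)
    finally show ?thesis .
  qed
  then show ?thesis by (simp add: l vec_eq_iff matrix_vector_mult_def)
qed

text \<open>The vectors \<open>a i\<close> are the rescaled orthogonal projections of the standard basis onto \<open>E\<close>.\<close>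

lemma eigenspace_coordinates:
  fixes G :: "('v::finite, 'e) pre_digraph"
  assumes G: "graph G" "verts G = UNIV" "vertex_transitive G"
    and E: "is_eigenspace (adjacency_matrix G) E"
  shows "\<exists>a. \<forall>i. a i \<in> E \<and> norm (a i) = 1 \<and>
    (\<forall>x\<in>E. sqrt (real CARD('v) / real (dim E)) * x $ i = x \<bullet> a i)"
proof -
  interpret nonzero_subspace E
    using E subspace_eigenspace[OF E] unfolding is_eigenspace_def by unfold_locales blast+
  have "\<exists>p. p \<in> E \<and> (\<forall>x\<in>E. x $ i = x \<bullet> p)" for i
  proof -
    obtain p q where p: "p \<in> E" and q: "\<And>w. w \<in> E \<Longrightarrow> orthogonal q w" and pq: "axis i 1 = p + q"
      using orthogonal_subspace_decomp_exists[of E "axis i 1"] span_eq_iff[THEN iffD2, OF subspace] by metis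
    have "x $ i = x \<bullet> p" if "x \<in> E" for x
    proof -
      have "x $ i = x \<bullet> axis i 1" by (simp add: inner_axis)
      also have "\<dots> = x \<bullet> p" using q[OF that] by (simp add: pq inner_add_right orthogonal_def inner_commute)
      finally show ?thesis .
    qed
    with p show ?thesis by blast
  qed
  then obtain p where p: "\<And>i. p i \<in> E" and coord: "\<And>i x. x \<in> E \<Longrightarrow> x $ i = x \<bullet> p i" by metis
  \<comment> \<open>An automorphism taking \<open>i\<close> to \<open>j\<close> moves coordinate
    \<open>j\<close> of \<open>p j\<close> to position \<open>i\<close> without changing the norm.
    Reproducing that coordinate by \<open>p i\<close>, Cauchy-Schwarz bounds
    \<open>(norm (p j))\<^sup>2\<close> by the product of the two norms.\<close>
  have le: "norm (p j) \<le> norm (p i)" for i j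
  proof -
    obtain h where h: "graph_automorphism G h" and hij: "iso_verts h i = j"
      using G(2,3) unfolding vertex_transitive_def by (metis UNIV_I)
    define y where "y = (\<chi> k. p j $ iso_verts h k)"
    have y: "y \<in> E"
      unfolding y_def by (rule eigenspace_permute[OF G(1) h G(2) E p])
    have "norm y = norm (p j)"
      unfolding y_def norm_vec_def L2_set_def
      using sum.reindex_bij_betw[OF automorphism_adjacency(1)[OF G(1) h G(2)], of "\<lambda>k. (norm (p j $ k))\<^sup>2"] by simp
    have "norm (p j) * norm (p j) = p j $ j"
      by (simp add: coord[OF p] dot_square_norm power2_eq_square)
    also have "\<dots> = y $ i" by (simp add: y_def hij)
    also have "\<dots> = y \<bullet> p i" by (rule coord[OF y])
    also have "\<dots> \<le> norm (p j) * norm (p i)" using norm_cauchy_schwarz[of y "p i"] \<open>norm y = norm (p j)\<close> by simp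
    finally show ?thesis by (cases "norm (p j) = 0") (auto simp: mult_le_cancel_left)
  qed
  then have const: "norm (p i) = norm (p j)" for i j by (simp add: order_antisym)
  \<comment> \<open>Both sides are the trace of the orthogonal projection onto \<open>E\<close>, in
    the standard basis and in \<open>B\<close>. As all norms agree, each square is
    \<open>real d / real CARD('v)\<close>.\<close>
  have "(\<Sum>i\<in>UNIV. (norm (p i))\<^sup>2) = (\<Sum>i\<in>UNIV. \<Sum>b\<in>B. (b $ i)\<^sup>2)"
    by (simp add: norm_eq_sum_B[OF p] coord[OF B_subset])
  also have "\<dots> = (\<Sum>b\<in>B. (norm b)\<^sup>2)"
    by (subst sum.swap) (simp add: norm_vec_def L2_set_def sum_nonneg)
  also have "\<dots> = real d"
    using B_inner by (simp add: power2_norm_eq_inner card_B)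
  finally have sum: "(\<Sum>i\<in>UNIV. (norm (p i))\<^sup>2) = real d" .
  define \<kappa> where "\<kappa> = sqrt (real CARD('v) / real d)"
  have norm_p: "\<kappa> * norm (p i) = 1" for i
  proof -
    have "(\<Sum>j\<in>UNIV. (norm (p j))\<^sup>2) = (\<Sum>j\<in>(UNIV::'v set). (norm (p i))\<^sup>2)"
      by (intro sum.cong refl arg_cong[of "norm _" "norm _" "\<lambda>z. z\<^sup>2"] const)
    then have eq: "real CARD('v) * (norm (p i))\<^sup>2 = real d"
      unfolding sum by (simp only: sum_constant)
    have nz: "real d \<noteq> 0" using dim_pos by (simp only: of_nat_eq_0_iff not_gr_zero)
    have "(\<kappa> * norm (p i))\<^sup>2 = real CARD('v) / real d * (norm (p i))\<^sup>2"
      unfolding \<kappa>_def power_mult_distrib by (simp only: real_sqrt_pow2 divide_nonneg_nonneg of_nat_0_le_iff)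
    also have "\<dots> = 1\<^sup>2"
      by (simp only: times_divide_eq_left eq divide_self[OF nz] one_power2)
    finally have "(\<kappa> * norm (p i))\<^sup>2 = 1\<^sup>2" .
    then show ?thesis by (rule power2_eq_imp_eq) (auto simp: \<kappa>_def)
  qed
  show ?thesis
  proof (intro exI[of _ "\<lambda>i. \<kappa> *\<^sub>R p i"] allI conjI ballI)
    show "\<kappa> *\<^sub>R p i \<in> E" for i by (rule subspace_scale[OF subspace p])
    show "norm (\<kappa> *\<^sub>R p i) = 1" for i using norm_p[of i] by (simp add: \<kappa>_def)
    show "sqrt (real CARD('v) / real d) * x $ i = x \<bullet> \<kappa> *\<^sub>R p i" if "x \<in> E" for x i
      by (simp add: coord[OF that] \<kappa>_def)
  qed
qed

section \<open>The deviation bound\<close>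

text \<open>Everything is measured in \<open>X = M * \<epsilon>\<^sup>2\<close>: the staircases have
  exponent at least \<open>X / 512\<close>, half of which absorbs the number of sign patterns, and
  the norm has exponent \<open>X / 1024\<close>.\<close>

lemma tail_bound_numerics:
  fixes \<epsilon> M :: real and K :: nat
  assumes \<epsilon>: "0 < \<epsilon>" "\<epsilon> \<le> 1" and M: "M > 1" and big: "331776 \<le> (M - 1) * \<epsilon> ^ 5" and K: "real K \<le> 256 / \<epsilon>\<^sup>2"
    and c: "c = 1 / 589824"
  shows "2 ^ K * exp (- ((\<epsilon> / 4)\<^sup>2 * M / (2 * pi\<^sup>2))) + 2 * exp (- M * (\<epsilon> / 8)\<^sup>2 / 16)
    \<le> 48 * sqrt pi / \<epsilon> powr (3/2) * exp (- c * (M - 1) * \<epsilon> ^ 5)"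
proof -
  define X where "X = M * \<epsilon>\<^sup>2"
  have X: "X > 0" using \<epsilon> M by (simp add: X_def)
  have e52: "(M - 1) * \<epsilon> ^ 5 \<le> X"
  proof -
    have "(M - 1) * \<epsilon> ^ 5 \<le> M * \<epsilon>\<^sup>2"
      using \<epsilon> M by (intro mult_mono power_decreasing) auto
    then show ?thesis by (simp add: X_def)
  qed
  \<comment> \<open>Here 1296 = 331776 / 256; that it exceeds 1024 is what lets \<open>2 ^ K\<close>
    be absorbed.\<close>
  have "256 / \<epsilon>\<^sup>2 \<le> X / 1296"
  proof -
    have "331776 \<le> (M - 1) * \<epsilon> ^ 5" by (rule big)
    also have "\<dots> \<le> M * \<epsilon> ^ 4"
      using \<epsilon> M by (intro mult_mono power_decreasing) auto
    finally have "331776 / \<epsilon>\<^sup>2 \<le> X"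
      using \<epsilon> by (simp add: X_def divide_le_eq power2_eq_square power4_eq_xxxx mult.assoc)
    then show ?thesis by simp
  qed
  with K have KX: "real K \<le> X / 1296" by linarith
  have pi2: "X / 512 \<le> (\<epsilon> / 4)\<^sup>2 * M / (2 * pi\<^sup>2)"
  proof -
    have "pi\<^sup>2 \<le> 4\<^sup>2" using pi_less_4 by (intro power_mono) auto
    then have "X / (32 * 4\<^sup>2) \<le> X / (32 * pi\<^sup>2)"
      using X by (intro divide_left_mono) auto
    then show ?thesis by (simp add: X_def power_divide mult.commute)
  qed
  have "(2::real) ^ K \<le> exp (real K)"
    using exp_ge_add_one_self[of 1] power_mono[of 2 "exp 1 :: real" K] by (simp add: exp_of_nat_mult[symmetric])
  then have "2 ^ K * exp (- ((\<epsilon> / 4)\<^sup>2 * M / (2 * pi\<^sup>2))) \<le> exp (real K) * exp (- (X / 512))"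
    using pi2 by (intro mult_mono) auto
  also have "\<dots> \<le> exp (- X / 1024)"
    using KX X by (simp add: exp_add[symmetric])
  finally have 1: "2 ^ K * exp (- ((\<epsilon> / 4)\<^sup>2 * M / (2 * pi\<^sup>2))) \<le> exp (- X / 1024)" .
  have 2: "exp (- M * (\<epsilon> / 8)\<^sup>2 / 16) = exp (- X / 1024)"
    by (simp add: X_def power_divide)
  have 3: "exp (- X / 1024) \<le> exp (- c * (M - 1) * \<epsilon> ^ 5)"
  proof -
    have "c * ((M - 1) * \<epsilon> ^ 5) \<le> 1 / 1024 * X"
      using e52 X \<epsilon> M by (intro mult_mono) (auto simp: c)
    then show ?thesis by (simp add: mult.assoc)
  qed
  have 4: "3 \<le> 48 * sqrt pi / \<epsilon> powr (3/2)"
  proof -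
    have "\<epsilon> powr (3/2) \<le> 1" "\<epsilon> powr (3/2) > 0"
      using \<epsilon> by (auto intro: powr_le1)
    moreover have "1 \<le> sqrt pi" using pi_ge_two by (intro real_le_rsqrt) simp
    ultimately show ?thesis by (simp only: pos_le_divide_eq)
  qed
  have "2 ^ K * exp (- ((\<epsilon> / 4)\<^sup>2 * M / (2 * pi\<^sup>2))) + 2 * exp (- M * (\<epsilon> / 8)\<^sup>2 / 16) \<le> 3 * exp (- X / 1024)"
    unfolding 2 using 1 by linarith
  also have "\<dots> \<le> 48 * sqrt pi / \<epsilon> powr (3/2) * exp (- c * (M - 1) * \<epsilon> ^ 5)"
    using 3 4 by (intro mult_mono) auto
  finally show ?thesis .
qed

text \<open>The hypotheses on \<open>a\<close> make each rescaled coordinate standard normal, so the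
  mean of the average is exactly the Gaussian integral. Averaging over \<open>n\<close> coordinates
  turns the slope 2 into the Lipschitz constant \<open>2 / sqrt (real d)\<close>.\<close>

lemma staircase_concentration:
  fixes E :: "(real^'v::finite) set" and a :: "'v \<Rightarrow> real^'v"
  defines "n \<equiv> real CARD('v)" and "\<kappa> \<equiv> sqrt (real CARD('v) / real (dim E))"
  assumes E: "nonzero_subspace E"
    and a: "\<And>i. a i \<in> E" "\<And>i. norm (a i) = 1" "\<And>i x. x \<in> E \<Longrightarrow> \<kappa> * x $ i = x \<bullet> a i"
    and w: "\<And>k. \<bar>w k\<bar> \<le> 1" and h: "h > 0" and \<tau>: "\<tau> > 0"
  shows "measure (nonzero_subspace.gauss E) {x. (\<Sum>i\<in>UNIV. staircase h R K w (\<kappa> * x $ i)) / n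
      - (\<integral>z. staircase h R K w z \<partial>std_normal_distribution) \<ge> \<tau>}
    \<le> exp (- (\<tau>\<^sup>2 * real (dim E) / (2 * pi\<^sup>2)))"
proof -
  interpret nonzero_subspace E by fact
  let ?S = "staircase h R K w" and ?S' = "staircase' h R K w"
  define F where "F x = (\<Sum>i\<in>UNIV. ?S (\<kappa> * x $ i)) / n" for x :: "real^'v"
  define D where "D x = (\<chi> i. \<kappa> / n * ?S' (\<kappa> * x $ i))" for x :: "real^'v"
  have n: "n > 0" by (simp add: n_def)
  have dpos: "real d > 0" using dim_pos by (simp only: of_nat_0_less_iff)
  have \<kappa>: "\<kappa> > 0" using dpos by (simp add: \<kappa>_def)
  have S_bound: "\<bar>?S z\<bar> \<le> real K * h" for z by (rule abs_staircase_le[OF w h])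
  have mean: "(\<integral>x. F x \<partial>gauss) = (\<integral>z. ?S z \<partial>std_normal_distribution)"
  proof -
    have "(\<integral>x. ?S (\<kappa> * x $ i) \<partial>gauss) = (\<integral>z. ?S z \<partial>std_normal_distribution)" for i
    proof -
      have "(\<integral>x. ?S (\<kappa> * x $ i) \<partial>gauss) = (\<integral>x. ?S (x \<bullet> a i) \<partial>gauss)"
        using AE_gauss_in by (intro integral_cong_AE) (auto simp: a(3))
      also have "\<dots> = (\<integral>z. ?S z \<partial>distr gauss borel (\<lambda>x. x \<bullet> a i))"
        by (rule integral_distr[symmetric]) measurable
      also have "\<dots> = (\<integral>z. ?S z \<partial>std_normal_distribution)"
        by (simp only: distr_gauss_inner[OF a(1,2)])
      finally show ?thesis .
    qed
    moreover have "integrable gauss (\<lambda>x. ?S (\<kappa> * x $ i))" for i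
      using S_bound by (intro gauss.integrable_const_bound[of _ "real K * h"]) auto
    ultimately show ?thesis
      using n by (simp add: F_def n_def)
  qed
  have "measure gauss {x. F x - (\<integral>y. F y \<partial>gauss) \<ge> \<tau>} \<le> exp (- 2 * \<tau>\<^sup>2 / (pi\<^sup>2 * (2 / sqrt (real d))\<^sup>2))"
  proof (rule gauss_concentration[of F D])
    fix x :: "real^'v"
    have "((\<lambda>x. ?S (\<kappa> * x $ i)) has_derivative (\<lambda>h. ?S' (\<kappa> * x $ i) * (\<kappa> * h $ i))) (at x)" for i
    proof -
      have 1: "((\<lambda>x. \<kappa> * x $ i) has_derivative (\<lambda>h. \<kappa> * h $ i)) (at x)"
        by (intro bounded_linear_imp_has_derivative bounded_linear_const_mult bounded_linear_vec_nth)
      have 2: "(?S has_derivative (\<lambda>h. ?S' (\<kappa> * x $ i) * h)) (at (\<kappa> * x $ i))"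
        using DERIV_staircase[OF h] by (simp add: has_field_derivative_def)
      show ?thesis by (rule has_derivative_compose[OF 1 2])
    qed
    then have "(F has_derivative (\<lambda>h. (\<Sum>i\<in>UNIV. ?S' (\<kappa> * x $ i) * (\<kappa> * h $ i)) / n)) (at x)"
      unfolding F_def[abs_def] by (intro bounded_linear.has_derivative[OF bounded_linear_divide] has_derivative_sum)
    moreover have "(\<Sum>i\<in>UNIV. ?S' (\<kappa> * x $ i) * (\<kappa> * h $ i)) / n = D x \<bullet> h" for h
      by (simp add: D_def inner_vec_def sum_divide_distrib mult_ac)
    ultimately show "(F has_derivative (\<lambda>h. D x \<bullet> h)) (at x)" by simp
  next
    show "continuous_on UNIV D"
      unfolding D_def
      by (intro continuous_on_vec_lambda continuous_intros continuous_on_compose2[OF continuous_on_staircase'[OF h, of UNIV]]) auto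
  next
    fix x v :: "real^'v"
    \<comment> \<open>The squared gradient has \<open>n\<close> entries of size at most
      \<open>(2 * \<kappa> / n)\<^sup>2\<close>, in total \<open>4 * \<kappa>\<^sup>2 / n\<close>,
      and \<open>\<kappa>\<^sup>2 = n / real d\<close>.\<close>
    have "norm (D x) \<le> 2 / sqrt (real d)"
    proof (rule power2_le_imp_le)
      have "(norm (D x))\<^sup>2 = (\<Sum>i\<in>UNIV. (\<kappa> / n)\<^sup>2 * (?S' (\<kappa> * x $ i))\<^sup>2)"
        by (simp add: D_def norm_vec_def L2_set_def sum_nonneg power_mult_distrib power_divide)
      also have "\<dots> \<le> (\<Sum>i\<in>(UNIV :: 'v set). (\<kappa> / n)\<^sup>2 * 2\<^sup>2)"
        using abs_staircase'_le[OF w] by (intro sum_mono mult_left_mono power2_le_iff_abs_le[THEN iffD2]) auto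
      also have "\<dots> = n * ((\<kappa> / n)\<^sup>2 * 2\<^sup>2)" by (simp add: n_def)
      also have "\<dots> = (2 / sqrt (real d))\<^sup>2"
        using n dpos by (simp add: \<kappa>_def n_def[symmetric] power_divide power2_eq_square[of n])
      finally show "(norm (D x))\<^sup>2 \<le> (2 / sqrt (real d))\<^sup>2" .
    qed (use dpos in simp)
    then show "D x \<bullet> v \<le> 2 / sqrt (real d) * norm v"
      by (meson norm_cauchy_schwarz mult_right_mono norm_ge_zero order_trans)
  next
    fix x :: "real^'v"
    have "\<bar>\<Sum>i\<in>UNIV. ?S (\<kappa> * x $ i)\<bar> \<le> (\<Sum>i\<in>(UNIV :: 'v set). real K * h)"
      by (rule order_trans[OF sum_abs], rule sum_mono, rule S_bound)
    then show "\<bar>F x\<bar> \<le> real K * h"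
      using n by (simp add: F_def n_def divide_le_eq mult.commute)
  qed (use \<tau> dpos in auto)
  also have "- 2 * \<tau>\<^sup>2 / (pi\<^sup>2 * (2 / sqrt (real d))\<^sup>2) = - (\<tau>\<^sup>2 * real d / (2 * pi\<^sup>2))"
    using dpos by (simp add: power_divide)
  finally show ?thesis unfolding mean unfolding F_def .
qed

theorem theorem1p2:
  fixes G :: "('v::finite, 'e) pre_digraph"
    and E :: "(real^'v) set"
    and m :: nat and c \<epsilon> :: real
  assumes "graph G" and "verts G = UNIV" and "vertex_transitive G"
    and "is_eigenspace (adjacency_matrix G) E" and "dim E = m"
    and "m \<ge> 2"
    and "max ((192 * pi / sqrt (real m - 1)) powr (2/5)) (4 / (real m - 1)) \<le> \<epsilon>"
    and "\<epsilon> \<le> 1"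
    and "c = 3 powi (-2) * 2 powi (-16)"
  shows "\<P>(u in uniform_unit_sphere E.
            bl_dist (empirical_measure u) std_normal_distribution > \<epsilon>)
         \<le> 48 * sqrt pi / \<epsilon> powr (3/2) * exp (- c * (real m - 1) * \<epsilon> ^ 5)"
proof -
  have E: "nonzero_subspace E"
    using assms(4) subspace_eigenspace[OF assms(4)] unfolding is_eigenspace_def by unfold_locales blast+
  then interpret nonzero_subspace E .
  have m: "real m > 1" using assms(6) by simp
  define z where "z = 192 * pi / sqrt (real m - 1)"
  have z: "z > 0" using m by (simp add: z_def)
  have z_le: "z powr (2/5) \<le> \<epsilon>" using assms(7) by (simp add: z_def)
  have "0 < z powr (2/5)" using z by simp
  then have \<epsilon>: "0 < \<epsilon>" using z_le by linarith
  \<comment> \<open>The fifth power turns the exponent 2/5 into a square; 331776 is the square of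
    192 * 3, with 3 as a lower bound for \<open>pi\<close>.\<close>
  have "331776 \<le> (real m - 1) * \<epsilon> ^ 5"
  proof -
    have "(z powr (2/5)) ^ 5 = (z powr (2/5)) powr real 5"
      by (rule powr_realpow[symmetric]) fact
    also have "\<dots> = z powr real 2"
      unfolding powr_powr by simp
    also have "\<dots> = z\<^sup>2" by (rule powr_realpow[OF z])
    finally have "z\<^sup>2 = (z powr (2/5)) ^ 5" by (rule sym)
    also have "\<dots> \<le> \<epsilon> ^ 5" using z_le by (intro power_mono) auto
    finally have "(192 * pi)\<^sup>2 \<le> (real m - 1) * \<epsilon> ^ 5"
      using m by (simp add: z_def power_divide divide_le_eq mult.commute)
    moreover have "(192 * 3)\<^sup>2 \<le> (192 * pi)\<^sup>2"
      using pi_gt3 by (intro power_mono) auto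
    ultimately show ?thesis by simp
  qed
  obtain a where a: "\<And>i. a i \<in> E" "\<And>i. norm (a i) = 1"
    "\<And>i x. x \<in> E \<Longrightarrow> sqrt (real CARD('v) / real (dim E)) * x $ i = x \<bullet> a i"
    using eigenspace_coordinates[OF assms(1-4)] by metis
  \<comment> \<open>An integer of the size of \<open>1 / \<epsilon>\<close>, so that mesh and cutoff
    fit exactly and \<open>K\<close> is a natural number.\<close>
  define q where "q = nat \<lceil>1 / \<epsilon>\<rceil>"
  have q: "1 / \<epsilon> \<le> real q" "real q \<le> 2 / \<epsilon>" "real q > 0"
  proof -
    show "1 / \<epsilon> \<le> real q" unfolding q_def by linarith
    moreover have "1 / \<epsilon> \<ge> 1" using \<epsilon> assms(8) by simp
    moreover have "real q \<le> 1 / \<epsilon> + 1" using \<open>1 / \<epsilon> \<ge> 1\<close> unfolding q_def by linarith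
    moreover have "2 / \<epsilon> = 1 / \<epsilon> + 1 / \<epsilon>" by simp
    ultimately show "real q \<le> 2 / \<epsilon>" "real q > 0" by linarith+
  qed
  \<comment> \<open>With these choices \<open>h \<le> \<epsilon> / 8\<close> and
    \<open>1 / R\<^sup>2 \<le> \<epsilon>\<^sup>2 / 16\<close>, while \<open>K = 2 * R / h\<close>
    stays below \<open>256 / \<epsilon>\<^sup>2\<close>.\<close>
  define h where "h = 1 / (8 * real q)"
  define R where "R = 4 * real q"
  define K where "K = 64 * q\<^sup>2"
  have h: "0 < h" "h \<le> \<epsilon> / 8"
    using q \<epsilon> by (auto simp: h_def field_simps)
  have R: "R > 0" using q by (simp add: R_def)
  have K: "real K * h = 2 * R" using q by (simp add: K_def h_def R_def power2_eq_square)
  have K_le: "real K \<le> 256 / \<epsilon>\<^sup>2"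
    using power_mono[OF q(2), of 2] by (simp add: K_def power_divide)
  let ?sgn = "\<lambda>A k. if k \<in> A then 1 else - 1 :: real"
  let ?dev = "\<lambda>A x. (\<Sum>i\<in>UNIV. staircase h R K (?sgn A) (sqrt (real CARD('v) / real d) * x $ i)) / real CARD('v)
      - (\<integral>z. staircase h R K (?sgn A) z \<partial>std_normal_distribution)"
  define Dev where "Dev A = {x::real^'v. ?dev A x \<ge> \<epsilon> / 4}" for A
  define Nor where "Nor = {x::real^'v. \<bar>(norm x)\<^sup>2 / real d - 1\<bar> \<ge> \<epsilon> / 8}"
  define Bad where "Bad = (\<Union>A\<in>Pow {..<K}. Dev A) \<union> Nor"
  have Dev_sets [measurable]: "Dev A \<in> sets borel" for A
    unfolding Dev_def by measurable
  have Nor_sets [measurable]: "Nor \<in> sets borel"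
    unfolding Nor_def by measurable
  have good: "bl_dist (empirical_measure (sgn x)) std_normal_distribution \<le> \<epsilon>" if "x \<notin> Bad" for x
  proof -
    have nor: "\<bar>(norm x)\<^sup>2 / real d - 1\<bar> \<le> \<epsilon> / 8"
      using that by (auto simp: Bad_def Nor_def)
    have "x \<noteq> 0" using nor assms(8) by auto
    have "bl_dist (empirical_measure (sgn x)) std_normal_distribution
        \<le> \<epsilon> / 8 + 2 * h + 2 * (2 + \<epsilon> / 8) / R\<^sup>2 + \<epsilon> / 4"
    proof (rule bl_dist_empirical_measure_sgn_le[OF _ \<open>x \<noteq> 0\<close> nor h(1) R K])
      show "real d > 0" using dim_pos by (simp only: of_nat_0_less_iff)
      fix A :: "nat set"
      \<comment> \<open>Only the first \<open>K\<close> signs enter a staircase, which reduces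
        arbitrary sets to the finitely many in \<open>Bad\<close>.\<close>
      have "staircase h R K (?sgn A) = staircase h R K (?sgn (A \<inter> {..<K}))"
        unfolding staircase_def by (intro ext sum.cong) auto
      moreover have "x \<notin> Dev (A \<inter> {..<K})"
        using that by (auto simp: Bad_def)
      ultimately show "let w = ?sgn A in
        (\<Sum>i\<in>UNIV. staircase h R K w (sqrt (real CARD('v) / real d) * x $ i)) / real CARD('v)
        - (\<integral>z. staircase h R K w z \<partial>std_normal_distribution) \<le> \<epsilon> / 4"
        by (simp add: Dev_def Let_def)
    qed
    \<comment> \<open>The budget in units of \<epsilon>: 1/8 for the norm, at most 1/4 for the mesh,
      17/64 for the cutoff and 1/4 for the deviation, in total 57/64.\<close>
    also have "\<dots> \<le> \<epsilon>"
    proof -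
      have "1 / R\<^sup>2 \<le> \<epsilon> / 16"
      proof -
        have "1 / R\<^sup>2 = (1 / real q)\<^sup>2 / 16" by (simp add: R_def power_mult_distrib power_divide)
        also have "(1 / real q)\<^sup>2 \<le> \<epsilon>\<^sup>2"
          using q \<epsilon> by (intro power_mono) (auto simp: field_simps)
        also have "\<epsilon>\<^sup>2 \<le> \<epsilon>" using \<epsilon> assms(8) by (simp add: power2_eq_square mult_left_le)
        finally show ?thesis by simp
      qed
      then have "2 * (2 + \<epsilon> / 8) * (1 / R\<^sup>2) \<le> 2 * (2 + 1 / 8) * (\<epsilon> / 16)"
        using \<epsilon> assms(8) by (intro mult_mono) auto
      then have "2 * (2 + \<epsilon> / 8) / R\<^sup>2 \<le> 17 / 64 * \<epsilon>" by simp
      moreover have "\<epsilon> / 8 + 2 * h + Y + \<epsilon> / 4 \<le> \<epsilon>" if "Y \<le> 17 / 64 * \<epsilon>" for Y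
        using that h \<epsilon> by linarith
      ultimately show ?thesis by blast
    qed
    finally show ?thesis .
  qed
  have "measure gauss Bad \<le> 2 ^ K * exp (- ((\<epsilon> / 4)\<^sup>2 * real m / (2 * pi\<^sup>2))) + 2 * exp (- real m * (\<epsilon> / 8)\<^sup>2 / 16)"
  proof -
    have "measure gauss (\<Union>A\<in>Pow {..<K}. Dev A) \<le> (\<Sum>A\<in>Pow {..<K}. measure gauss (Dev A))"
      by (rule measure_UNION_le) auto
    also have "\<dots> \<le> (\<Sum>A\<in>Pow {..<K}. exp (- ((\<epsilon> / 4)\<^sup>2 * real d / (2 * pi\<^sup>2))))"
    proof (rule sum_mono)
      fix A :: "nat set"
      show "measure gauss (Dev A) \<le> exp (- ((\<epsilon> / 4)\<^sup>2 * real d / (2 * pi\<^sup>2)))"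
        unfolding Dev_def by (rule staircase_concentration[OF E a]) (use h(1) \<epsilon> in auto)
    qed
    also have "\<dots> = 2 ^ K * exp (- ((\<epsilon> / 4)\<^sup>2 * real m / (2 * pi\<^sup>2)))"
      by (simp add: card_Pow assms(5))
    finally have "measure gauss (\<Union>A\<in>Pow {..<K}. Dev A) \<le> 2 ^ K * exp (- ((\<epsilon> / 4)\<^sup>2 * real m / (2 * pi\<^sup>2)))" .
    moreover have "measure gauss Nor \<le> 2 * exp (- real m * (\<epsilon> / 8)\<^sup>2 / 16)"
      using gauss_norm_concentration[of "\<epsilon> / 8"] \<epsilon> assms(8) by (simp add: Nor_def assms(5))
    moreover have "measure gauss Bad \<le> measure gauss (\<Union>A\<in>Pow {..<K}. Dev A) + measure gauss Nor"
      unfolding Bad_def by (intro measure_Un_le) auto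
    ultimately show ?thesis by linarith
  qed
  also have "\<dots> \<le> 48 * sqrt pi / \<epsilon> powr (3/2) * exp (- c * (real m - 1) * \<epsilon> ^ 5)"
    by (rule tail_bound_numerics) (use \<epsilon> assms(8,9) m K_le \<open>331776 \<le> _\<close> in \<open>auto simp: power_int_minus\<close>)
  finally have bound: "measure gauss Bad \<le> 48 * sqrt pi / \<epsilon> powr (3/2) * exp (- c * (real m - 1) * \<epsilon> ^ 5)" .
  let ?A = "{u::real^'v. bl_dist (empirical_measure u) std_normal_distribution > \<epsilon>}"
  \<comment> \<open>Measurability of \<open>?A\<close> is left open by a case distinction:
    \<open>measure\<close> gives a set outside the sigma-algebra the default value 0, so the bound
    holds either way.\<close>
  have "measure (uniform_unit_sphere E) ?A \<le> measure gauss Bad"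
  proof (cases "?A \<in> sets borel")
    case True
    have sgn_meas: "(sgn :: real^'v \<Rightarrow> _) \<in> borel_measurable borel"
      unfolding sgn_div_norm[abs_def] by measurable
    then have "measure (uniform_unit_sphere E) ?A = measure gauss (sgn -` ?A)"
      unfolding uniform_unit_sphere_eq using True by (subst measure_distr) auto
    also have "\<dots> \<le> measure gauss Bad"
    proof (rule gauss.finite_measure_mono)
      show "sgn -` ?A \<subseteq> Bad" using good by force
      show "Bad \<in> sets gauss" unfolding Bad_def sets_gauss by (intro sets.Un sets.finite_UN Dev_sets Nor_sets) simp
    qed
    finally show ?thesis .
  next
    case False
    then have "measure (uniform_unit_sphere E) ?A = 0"
      by (intro measure_notin_sets) (simp add: uniform_unit_sphere_def)
    then show ?thesis by simp
  qed
  also note bound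
  finally show ?thesis by (simp add: uniform_unit_sphere_def)
qed

end
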